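(* The homology of the species of chain complexes $C_\bullet^{CE}(\tilde{\mathcal L})$ is concentrated in degrees zero and one. Moreover, $$\dim H_k^{CE}(\tilde{\mathcal L})(n)=\begin{cases}(n-2)^n,& k=0,\ n\ge 3,\\ 1,& k=1,\ n=1,\\ 0,&\text{otherwise.}\end{cases}$$
   Context: All vector spaces are over a field $\Bbbk$ of characteristic zero; complexes are homologically graded (differentials have degree $-1$); $s$ is a formal symbol of degree $1$, $sC=\Bbbk s\otimes C$. A species is a functor from finite sets and bijections to graded vector spaces; its arity $n$ component is its value on $\{1,\dots,n\}$. The tensor product is $(\mathcal A\otimes\mathcal B)(I)=\bigoplus_{I=J\sqcup K}\mathcal A(J)\otimes\mathcal B(K)$ with Koszul signs in the symmetry, and (dg) Lie algebras in species are defined with respect to it. Rooted trees are directed graphs with all edges directed towards the root. $\mathrm{RT}(I)$ has basis the rooted trees with vertex set $I$. A directed cycle of rooted trees on $I\neq\varnothing$ is a connected directed graph with vertex set $I$ in which every vertex has exactly one outgoing edge (loops allowed). $\mathrm{Cyc}^+(\mathrm{RT})(I)$ has basis the directed cycles of rooted trees on $I$ whose directed cycle has length at least two. For rooted trees $T_1,T_2$ on disjoint vertex sets, $T_1\triangleleft T_2$ is the sum over all vertices $v$ of $T_1$ of the tree obtained by adding an edge from the root of $T_2$ to $v$; $[T_1,T_2]=T_1\triangleleft T_2-T_2\triangleleft T_1$ makes $\mathrm{RT}$ a Lie algebra in species. For a directed cycle of rooted trees $C$ and a rooted tree $T$ on disjoint vertex sets, $C\blacktriangleleft T$ is the sum over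 all vertices $v$ of $C$ of the graph obtained by adding an edge from the root of $T$ to $v$; this makes $\mathrm{Cyc}^+(\mathrm{RT})$ a right module over the Lie algebra $\mathrm{RT}$. The reduced divergence $\mathrm{div}_0\colon\mathrm{RT}\to\mathrm{Cyc}^+(\mathrm{RT})$ sends $T$ to the sum over all non-root vertices $v$ of $T$ of the graph obtained by adding an edge from the root of $T$ to $v$; it is a $1$-cocycle: $\mathrm{div}_0([T_1,T_2])=\mathrm{div}_0(T_1)\blacktriangleleft T_2-\mathrm{div}_0(T_2)\blacktriangleleft T_1$. $\tilde{\mathcal L}$ is the dg Lie algebra in species $\mathrm{RT}\oplus s^{-1}\mathrm{Cyc}^+(\mathrm{RT})$ with differential $d(T)=s^{-1}\mathrm{div}_0(T)$, $d(s^{-1}C)=0$, and brackets given by $[T_1,T_2]$ on $\mathrm{RT}$, by $[T,s^{-1}C]=-s^{-1}(C\blacktriangleleft T)$ (the left action corresponding to the right one), and zero on $s^{-1}\mathrm{Cyc}^+(\mathrm{RT})$. For a dg Lie algebra $(L,d)$, the Chevalley--Eilenberg complex is $C^{CE}_\bullet(L)=(\mathrm{Com}^c(sL),d_1^{CE}+d_2^{CE})$, where $\mathrm{Com}^c(sL)=\bigoplus_{n\ge1}S^n(sL)$ is the cofree (non-counital) cocommutative coalgebra, $d_1^{CE}$ is the coderivation extending the differential of $sL$ induced by $d$, and $d_2^{CE}$ is the coderivation extending the degree $-1$ map $S^2(sL)\to sL$ induced by the Lie bracket; in terms of antisymmetric tensors, $d_2^{CE}(x_1\wedge\cdots\wedge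 x_n)=\sum_{i<j}(-1)^{i+j-1}[x_i,x_j]\wedge x_1\wedge\cdots\widehat{x_i}\cdots\widehat{x_j}\cdots\wedge x_n$ (with additional Koszul signs for elements of nonzero degree). $H^{CE}_\bullet(L)$ denotes its homology. *)

theory Defs
  imports "HOL-Library.Poly_Mapping" "Graph_Theory.Pair_Digraph" "Graph_Theory.Digraph_Component"
begin

section \<open>Free vector spaces and dimension of quotients\<close>

text \<open>
  The vector space over a field \<open>'k\<close> with basis \<open>'b\<close> is the type of finitely supported functions
  \<open>'b \<Rightarrow>\<^sub>0 'k\<close>; the basis vector belonging to \<open>b\<close> is \<open>Poly_Mapping.single b 1\<close>.
\<close>

definition smul :: "'k::field \<Rightarrow> ('b \<Rightarrow>\<^sub>0 'k) \<Rightarrow> ('b \<Rightarrow>\<^sub>0 'k)" where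
  "smul c p = Poly_Mapping.map ((*) c) p"

lemma lookup_smul: "Poly_Mapping.lookup (smul c p) b = c * Poly_Mapping.lookup p b"
  by (simp add: smul_def Poly_Mapping.map.rep_eq when_def)

global_interpretation free_vs: vector_space "smul :: 'k::field \<Rightarrow> ('b \<Rightarrow>\<^sub>0 'k) \<Rightarrow> ('b \<Rightarrow>\<^sub>0 'k)"
  by unfold_locales
    (auto intro!: poly_mapping_eqI simp: lookup_smul lookup_add algebra_simps)

abbreviation vec :: "'b \<Rightarrow> ('b \<Rightarrow>\<^sub>0 'k::field)" where
  "vec b \<equiv> Poly_Mapping.single b 1"

definition lin_ext :: "('b \<Rightarrow> ('c \<Rightarrow>\<^sub>0 'k)) \<Rightarrow> ('b \<Rightarrow>\<^sub>0 'k::field) \<Rightarrow> ('c \<Rightarrow>\<^sub>0 'k)" where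
  "lin_ext f p = (\<Sum>b\<in>Poly_Mapping.keys p. smul (Poly_Mapping.lookup p b) (f b))"

text \<open>
  \<open>quotient_has_dim Z B m\<close>: \<open>B \<subseteq> Z\<close> are subspaces and the quotient \<open>Z / B\<close> has a basis consisting of
  the classes of \<open>m\<close> elements; so \<open>Z / B\<close> is finite-dimensional of dimension \<open>m\<close>.
\<close>

definition quotient_has_dim :: "('b \<Rightarrow>\<^sub>0 'k::field) set \<Rightarrow> ('b \<Rightarrow>\<^sub>0 'k) set \<Rightarrow> nat \<Rightarrow> bool" where
  "quotient_has_dim Z B m \<longleftrightarrow>
     free_vs.subspace Z \<and> free_vs.subspace B \<and> B \<subseteq> Z \<and>
     (\<exists>S. S \<subseteq> Z \<and> finite S \<and> card S = m \<and>
          (\<forall>c. (\<Sum>x\<in>S. smul (c x) x) \<in> B \<longrightarrow> (\<forall>x\<in>S. c x = 0)) \<and>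
          (\<forall>z\<in>Z. \<exists>c. z - (\<Sum>x\<in>S. smul (c x) x) \<in> B))"


section \<open>Dg Lie algebras in species and their Chevalley--Eilenberg complexes\<close>

text \<open>
  A dg Lie algebra in species is presented by homogeneous bases and structure constants: \<open>L(I)\<close> has
  the basis consisting of all \<open>x \<in> gens\<close> with \<open>labels x = I\<close>, and \<open>dif\<close>, \<open>lie\<close> give the values of
  differential and bracket on basis elements. A bracket in species
  \<open>L(J) \<otimes> L(K) \<rightarrow> L(J \<squnion> K)\<close> only concerns disjoint \<open>J\<close>, \<open>K\<close>; the value of \<open>lie x y\<close> is
  never used unless \<open>labels x\<close> and \<open>labels y\<close> are disjoint. The action of bijections of label sets
  is not recorded, since it enters neither the tensor product nor the differential below.
\<close>

record (overloaded) ('v, 'b, 'k) dg_lie =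
  gens   :: "'b set"
  labels :: "'b \<Rightarrow> 'v set"
  deg    :: "'b \<Rightarrow> int"
  dif    :: "'b \<Rightarrow> ('b \<Rightarrow>\<^sub>0 'k)"
  lie    :: "'b \<Rightarrow> 'b \<Rightarrow> ('b \<Rightarrow>\<^sub>0 'k)"

definition sdeg :: "('v, 'b, 'k::field_char_0) dg_lie \<Rightarrow> 'b \<Rightarrow> int" where
  "sdeg L x = deg L x + 1"

text \<open>
  The word \<open>[x\<^sub>1, \<dots>, x\<^sub>n]\<close> stands for \<open>s x\<^sub>1 \<otimes> \<cdots> \<otimes> s x\<^sub>n\<close>. By the definition of the tensor product of
  species, \<open>words L I\<close> is a basis of \<open>(\<Oplus>\<^bsub>n\<ge>1\<^esub> (sL)\<^bsup>\<otimes>n\<^esup>)(I)\<close>.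
\<close>

definition words :: "('v, 'b, 'k::field_char_0) dg_lie \<Rightarrow> 'v set \<Rightarrow> 'b list set" where
  "words L I = {w. w \<noteq> [] \<and> set w \<subseteq> gens L \<and>
     sorted_wrt (\<lambda>x y. labels L x \<inter> labels L y = {}) w \<and> (\<Union>x\<in>set w. labels L x) = I}"

definition word_deg :: "('v, 'b, 'k::field_char_0) dg_lie \<Rightarrow> 'b list \<Rightarrow> int" where
  "word_deg L w = (\<Sum>x\<leftarrow>w. sdeg L x)"

definition tensors :: "('v, 'b, 'k::field_char_0) dg_lie \<Rightarrow> 'v set \<Rightarrow> int \<Rightarrow> ('b list \<Rightarrow>\<^sub>0 'k) set" where
  "tensors L I k = free_vs.span (vec ` {w \<in> words L I. word_deg L w = k})"

text \<open>
  \<open>S\<^sup>n(sL)\<close> is the space of coinvariants of \<open>(sL)\<^bsup>\<otimes>n\<^esup>\<close> under the symmetric group, acting with Koszul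
  signs; it suffices to divide out the relations given by adjacent transpositions. Hence
  \<open>C\<^sup>C\<^sup>E\<^sub>k(L)(I) = tensors L I k / sym_relations L I k\<close>.
\<close>

definition sym_relations :: "('v, 'b, 'k::field_char_0) dg_lie \<Rightarrow> 'v set \<Rightarrow> int \<Rightarrow> ('b list \<Rightarrow>\<^sub>0 'k) set" where
  "sym_relations L I k = free_vs.span
     {vec (u @ [x, y] @ v) - smul ((-1) powi (sdeg L x * sdeg L y)) (vec (u @ [y, x] @ v)) | u x y v.
        u @ [x, y] @ v \<in> words L I \<and> word_deg L (u @ [x, y] @ v) = k}"

text \<open>The coderivation extending \<open>s x \<mapsto> - s (d x)\<close>.\<close>

definition d1_CE :: "('v, 'b, 'k::field_char_0) dg_lie \<Rightarrow> 'b list \<Rightarrow> ('b list \<Rightarrow>\<^sub>0 'k)" where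
  "d1_CE L w = (\<Sum>i<length w. smul ((-1) powi (\<Sum>a<i. sdeg L (w ! a)))
     (lin_ext (\<lambda>b. vec (w[i := b])) (- dif L (w ! i))))"

text \<open>
  The coderivation extending \<open>s x \<cdot> s y \<mapsto> (-1)\<^bsup>|x|\<^esup> s [x, y]\<close>. In the summand for \<open>i < j\<close>, the factors
  \<open>s x\<^sub>i\<close> and \<open>s x\<^sub>j\<close> are first moved to the front, which produces the remaining Koszul sign. For
  \<open>L\<close> concentrated in degree \<open>0\<close> the total sign is \<open>(-1)\<^bsup>i+j-1\<^esup>\<close>, for positions \<open>i\<close>, \<open>j\<close> counted from 1.
\<close>

definition d2_CE :: "('v, 'b, 'k::field_char_0) dg_lie \<Rightarrow> 'b list \<Rightarrow> ('b list \<Rightarrow>\<^sub>0 'k)" where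
  "d2_CE L w = (\<Sum>j<length w. \<Sum>i<j.
     smul ((-1) powi (deg L (w ! i)
              + sdeg L (w ! i) * (\<Sum>a<i. sdeg L (w ! a))
              + sdeg L (w ! j) * (\<Sum>a\<in>{..<j} - {i}. sdeg L (w ! a))))
       (lin_ext (\<lambda>b. vec (b # nths w (- {i, j}))) (lie L (w ! i) (w ! j))))"

definition d_CE :: "('v, 'b, 'k::field_char_0) dg_lie \<Rightarrow> ('b list \<Rightarrow>\<^sub>0 'k) \<Rightarrow> ('b list \<Rightarrow>\<^sub>0 'k)" where
  "d_CE L = lin_ext (\<lambda>w. d1_CE L w + d2_CE L w)"

text \<open>
  Preimages in \<open>tensors L I k\<close> of the cycles and boundaries of the quotient complex. The homology
  \<open>H\<^sup>C\<^sup>E\<^sub>k(L)(I)\<close> is \<open>CE_cycles L I k / CE_boundaries L I k\<close>.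
\<close>

definition CE_cycles :: "('v, 'b, 'k::field_char_0) dg_lie \<Rightarrow> 'v set \<Rightarrow> int \<Rightarrow> ('b list \<Rightarrow>\<^sub>0 'k) set" where
  "CE_cycles L I k = {c \<in> tensors L I k. d_CE L c \<in> sym_relations L I (k - 1)}"

definition CE_boundaries :: "('v, 'b, 'k::field_char_0) dg_lie \<Rightarrow> 'v set \<Rightarrow> int \<Rightarrow> ('b list \<Rightarrow>\<^sub>0 'k) set" where
  "CE_boundaries L I k = {d_CE L c + r | c r. c \<in> tensors L I (k + 1) \<and> r \<in> sym_relations L I k}"

definition CE_homology_has_dim :: "('v, 'b, 'k::field_char_0) dg_lie \<Rightarrow> 'v set \<Rightarrow> int \<Rightarrow> nat \<Rightarrow> bool" where
  "CE_homology_has_dim L I k m \<longleftrightarrow> quotient_has_dim (CE_cycles L I k) (CE_boundaries L I k) m"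


section \<open>Rooted trees and directed cycles of rooted trees\<close>

definition rooted_tree :: "'v pair_pre_digraph \<Rightarrow> bool" where
  "rooted_tree T \<longleftrightarrow> pair_fin_digraph T \<and>
     (\<exists>r\<in>pverts T. out_degree T r = 0 \<and>
        (\<forall>v\<in>pverts T. v \<rightarrow>\<^sup>*\<^bsub>T\<^esub> r \<and> (v \<noteq> r \<longrightarrow> out_degree T v = 1)))"

definition root :: "'v pair_pre_digraph \<Rightarrow> 'v" where
  "root T = (THE r. r \<in> pverts T \<and> out_degree T r = 0)"

text \<open>Nonemptiness of the vertex set is part of \<^const>\<open>connected\<close>.\<close>

definition cycle_of_trees :: "'v pair_pre_digraph \<Rightarrow> bool" where
  "cycle_of_trees C \<longleftrightarrow> pair_fin_digraph C \<and> connected C \<and> (\<forall>v\<in>pverts C. out_degree C v = 1)"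

definition cycle_length :: "'v pair_pre_digraph \<Rightarrow> nat" where
  "cycle_length C = card {v \<in> pverts C. v \<rightarrow>\<^sup>+\<^bsub>C\<^esub> v}"

definition graft :: "'v pair_pre_digraph \<Rightarrow> 'v pair_pre_digraph \<Rightarrow> 'v \<Rightarrow> 'v pair_pre_digraph" where
  "graft G T v =
     \<lparr>pverts = pverts G \<union> pverts T, parcs = parcs G \<union> parcs T \<union> {(root T, v)}\<rparr>"

text \<open>
  Both \<open>T\<^sub>1 \<triangleleft> T\<^sub>2\<close>, for rooted trees, and the right action \<open>C \<blacktriangleleft> T\<close>, for a directed cycle of rooted trees.
\<close>

definition graft_sum :: "'v pair_pre_digraph \<Rightarrow> 'v pair_pre_digraph \<Rightarrow> ('v pair_pre_digraph \<Rightarrow>\<^sub>0 'k::field_char_0)" where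
  "graft_sum G T = (\<Sum>v\<in>pverts G. vec (graft G T v))"

definition div0 :: "'v pair_pre_digraph \<Rightarrow> ('v pair_pre_digraph \<Rightarrow>\<^sub>0 'k::field_char_0)" where
  "div0 T = (\<Sum>v\<in>pverts T - {root T}. vec (T\<lparr>parcs := insert (root T, v) (parcs T)\<rparr>))"


section \<open>The dg Lie algebra \<open>RT \<oplus> s\<^bsup>-1\<^esup> Cyc\<^sup>+(RT)\<close>\<close>

datatype 'v ltilde_gen =
    Tree "'v pair_pre_digraph"
  | DCyc "'v pair_pre_digraph"  \<comment> \<open>\<open>DCyc C\<close> stands for \<open>s\<^bsup>-1\<^esup> C\<close>\<close>

fun ltilde_labels :: "'v ltilde_gen \<Rightarrow> 'v set" where
  "ltilde_labels (Tree T) = pverts T"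
| "ltilde_labels (DCyc C) = pverts C"

fun ltilde_deg :: "'v ltilde_gen \<Rightarrow> int" where
  "ltilde_deg (Tree T) = 0"
| "ltilde_deg (DCyc C) = -1"

fun ltilde_dif :: "'v ltilde_gen \<Rightarrow> ('v ltilde_gen \<Rightarrow>\<^sub>0 'k::field_char_0)" where
  "ltilde_dif (Tree T) = lin_ext (\<lambda>C. vec (DCyc C)) (div0 T)"
| "ltilde_dif (DCyc C) = 0"

fun ltilde_lie :: "'v ltilde_gen \<Rightarrow> 'v ltilde_gen \<Rightarrow> ('v ltilde_gen \<Rightarrow>\<^sub>0 'k::field_char_0)" where
  "ltilde_lie (Tree S) (Tree T) = lin_ext (\<lambda>G. vec (Tree G)) (graft_sum S T - graft_sum T S)"
| "ltilde_lie (Tree T) (DCyc C) = - lin_ext (\<lambda>G. vec (DCyc G)) (graft_sum C T)"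
| "ltilde_lie (DCyc C) (Tree T) = lin_ext (\<lambda>G. vec (DCyc G)) (graft_sum C T)"
| "ltilde_lie (DCyc C) (DCyc D) = 0"

definition Ltilde :: "('v, 'v ltilde_gen, 'k::field_char_0) dg_lie" where
  "Ltilde = \<lparr>
     gens = Tree ` {T. rooted_tree T} \<union> DCyc ` {C. cycle_of_trees C \<and> cycle_length C \<ge> 2},
     labels = ltilde_labels,
     deg = ltilde_deg,
     dif = ltilde_dif,
     lie = ltilde_lie\<rparr>"

end

theory Submission
  imports Defs
begin

text \<open>
  Placing rooted trees and directed cycles of rooted trees on the blocks of a partition of \<open>I\<close> amounts
  to giving a partial function on \<open>I\<close> without fixed points: every vertex points to the end of its outgoing
  edge, and the function is undefined at the roots. The elements \<open>s T\<close> are odd and the elements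
  \<open>s s\<^sup>-\<^sup>1 C\<close> are even, so the Chevalley--Eilenberg complex is spanned by such functions together with an
  orientation of the set of roots, and the degree is the number of roots. The internal differential
  joins a root to the other vertices of its own tree, the bracket joins it to the vertices of the
  other components. The total differential therefore joins a root to all other elements of \<open>I\<close>, and
  up to sign the complex is the tensor product over \<open>i \<in> I\<close> of the complexes \<open>k \<rightarrow> k\<^bsup>I - {i}\<^esup>\<close>,
  \<open>1 \<mapsto> \<Sum>\<^sub>v v\<close>. For \<open>|I| \<ge> 2\<close> each factor has homology of dimension \<open>|I| - 2\<close> concentrated in degree
  \<open>0\<close>; for \<open>|I| = 1\<close> the only factor is \<open>k\<close> in degree \<open>1\<close>.
\<close>

section \<open>Linear extensions and quotients\<close>

text \<open>Homology is given by preimages of cycles and boundaries among words, before dividing by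
  the symmetric group. The passage to functions is therefore a linear map \<open>word_vec\<close> on
  words, and the crux is that it is onto with kernel exactly the span of the transposition
  relations. This holds because a function determines the factors of a word as its connected
  components, so that words with the same function differ by a permutation. Orientations become
  signs after fixing an injection \<open>idx\<close> of the labels into the naturals and comparing
  the roots of a word with the order of increasing \<open>idx\<close>. No tensor product over
  \<open>I\<close> is ever formed: a base value \<open>b i \<noteq> i\<close> is chosen for every
  \<open>i\<close>, the homotopy of one factor acts on the whole complex, and the factors are
  treated one at a time by induction on subsets of \<open>I\<close>. What survives are total
  functions avoiding \<open>i\<close> and \<open>b i\<close> at \<open>i\<close>, which explains
  \<open>(n - 2) ^ n\<close>.\<close>

lemma lin_ext_superset:
  assumes "finite B" "Poly_Mapping.keys p \<subseteq> B"
  shows "lin_ext f p = (\<Sum>b\<in>B. smul (Poly_Mapping.lookup p b) (f b))"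
  unfolding lin_ext_def
  by (rule sum.mono_neutral_left) (use assms in \<open>auto simp: in_keys_iff\<close>)

lemma lin_ext_add: "lin_ext f (p + q) = lin_ext f p + lin_ext f q"
proof -
  let ?B = "Poly_Mapping.keys p \<union> Poly_Mapping.keys q"
  have "Poly_Mapping.keys (p + q) \<subseteq> ?B"
    by (rule Poly_Mapping.keys_add)
  then show ?thesis
    by (simp add: lin_ext_superset[of ?B] lookup_add free_vs.scale_left_distrib sum.distrib)
qed

lemma lin_ext_smul: "lin_ext f (smul c p) = smul c (lin_ext f p)"
proof -
  have "Poly_Mapping.keys (smul c p) \<subseteq> Poly_Mapping.keys p"
    by (auto simp: in_keys_iff lookup_smul)
  then have "lin_ext f (smul c p)
      = (\<Sum>b\<in>Poly_Mapping.keys p. smul (Poly_Mapping.lookup (smul c p) b) (f b))"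
    by (intro lin_ext_superset) auto
  then show ?thesis
    by (simp add: lin_ext_def lookup_smul free_vs.scale_sum_right)
qed

lemma lin_ext_zero [simp]: "lin_ext f 0 = 0"
  by (simp add: lin_ext_def)

lemma lin_ext_minus: "lin_ext f (- p) = - lin_ext f p"
  using lin_ext_smul[of f "-1" p] by simp

lemma lin_ext_diff: "lin_ext f (p - q) = lin_ext f p - lin_ext f q"
  using lin_ext_add[of f p "- q"] by (simp add: lin_ext_minus)

lemma lin_ext_sum: "lin_ext f (\<Sum>x\<in>X. g x) = (\<Sum>x\<in>X. lin_ext f (g x))"
  by (induction X rule: infinite_finite_induct) (auto simp: lin_ext_add)

lemma lin_ext_vec [simp]: "lin_ext f (vec b) = f b"
  by (simp add: lin_ext_def)

lemma lin_ext_lin_ext: "lin_ext f (lin_ext g p) = lin_ext (\<lambda>b. lin_ext f (g b)) p"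
  by (simp add: lin_ext_def[of g] lin_ext_def[of _ p] lin_ext_sum lin_ext_smul)

lemma lin_ext_cong:
  "(\<And>b. b \<in> Poly_Mapping.keys p \<Longrightarrow> f b = g b) \<Longrightarrow> lin_ext f p = lin_ext g p"
  by (simp add: lin_ext_def)

lemma lin_ext_uminus_fun: "lin_ext (\<lambda>b. - f b) p = - lin_ext f p"
  by (simp add: lin_ext_def sum_negf)

lemma lin_ext_add_fun: "lin_ext (\<lambda>b. f b + g b) p = lin_ext f p + lin_ext g p"
  by (simp add: lin_ext_def sum.distrib free_vs.scale_right_distrib)

lemma lin_ext_diff_fun: "lin_ext (\<lambda>b. f b - g b) p = lin_ext f p - lin_ext g p"
  by (simp add: lin_ext_def sum_subtractf free_vs.scale_right_diff_distrib)

lemma lin_ext_vec_id: "lin_ext vec p = p"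
  by (rule poly_mapping_eqI)
    (simp add: lin_ext_def lookup_sum lookup_smul lookup_single when_def in_keys_iff
      if_distrib[of "(*) _"] cong: if_cong)

lemma lin_ext_in_subspace:
  assumes "free_vs.subspace V" "\<And>b. b \<in> Poly_Mapping.keys p \<Longrightarrow> f b \<in> V"
  shows "lin_ext f p \<in> V"
  unfolding lin_ext_def
  by (intro free_vs.subspace_sum free_vs.subspace_scale assms)

lemma subspace_keys: "free_vs.subspace {p :: 'b \<Rightarrow>\<^sub>0 'k::field. Poly_Mapping.keys p \<subseteq> S}"
proof (rule free_vs.subspaceI)
  fix p q :: "'b \<Rightarrow>\<^sub>0 'k"
  assume "p \<in> {p. Poly_Mapping.keys p \<subseteq> S}" "q \<in> {p. Poly_Mapping.keys p \<subseteq> S}"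
  then show "p + q \<in> {p. Poly_Mapping.keys p \<subseteq> S}"
    using Poly_Mapping.keys_add[of p q] by auto
qed (auto simp: in_keys_iff lookup_smul)

lemma span_vec: "free_vs.span (vec ` S) = {p :: 'b \<Rightarrow>\<^sub>0 'k::field. Poly_Mapping.keys p \<subseteq> S}"
proof (rule free_vs.span_unique)
  show "vec ` S \<subseteq> {p. Poly_Mapping.keys p \<subseteq> S}" by auto
  show "free_vs.subspace {p :: 'b \<Rightarrow>\<^sub>0 'k. Poly_Mapping.keys p \<subseteq> S}" by (rule subspace_keys)
  fix V :: "('b \<Rightarrow>\<^sub>0 'k) set" assume V: "vec ` S \<subseteq> V" "free_vs.subspace V"
  show "{p. Poly_Mapping.keys p \<subseteq> S} \<subseteq> V"
  proof
    fix p :: "'b \<Rightarrow>\<^sub>0 'k" assume "p \<in> {p. Poly_Mapping.keys p \<subseteq> S}"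
    then have "lin_ext vec p \<in> V" using V by (intro lin_ext_in_subspace) auto
    then show "p \<in> V" by (simp add: lin_ext_vec_id)
  qed
qed

text \<open>\<open>Z\<close> and \<open>B\<close> are full preimages inside \<open>T\<close>, so
  both contain the part of the kernel lying in \<open>T\<close>, and lifts of representatives for
  \<open>Z'\<close> modulo \<open>B'\<close> represent \<open>Z\<close> modulo \<open>B\<close>.
  Dimensions are thus carried from functions back to words without forming the quotient by the
  symmetry relations.\<close>

lemma quotient_has_dim_lift:
  assumes T: "free_vs.subspace T"
    and surj: "\<And>y. y \<in> Z' \<Longrightarrow> \<exists>x\<in>T. lin_ext \<phi> x = y"
    and Z: "Z = {x \<in> T. lin_ext \<phi> x \<in> Z'}" and B: "B = {x \<in> T. lin_ext \<phi> x \<in> B'}"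
    and q: "quotient_has_dim Z' B' m"
  shows "quotient_has_dim Z B m"
proof -
  have sub: "free_vs.subspace Z'" "free_vs.subspace B'" "B' \<subseteq> Z'"
    using q by (simp_all add: quotient_has_dim_def)
  obtain S where S: "S \<subseteq> Z'" "finite S" "card S = m"
    and ind: "\<forall>c. (\<Sum>x\<in>S. smul (c x) x) \<in> B' \<longrightarrow> (\<forall>x\<in>S. c x = 0)"
    and gen: "\<forall>z\<in>Z'. \<exists>c. z - (\<Sum>x\<in>S. smul (c x) x) \<in> B'"
    using q unfolding quotient_has_dim_def by - (elim conjE exE, rule that; assumption)
  obtain g where g: "\<And>y. y \<in> S \<Longrightarrow> g y \<in> T \<and> lin_ext \<phi> (g y) = y"
  proof -
    have "\<forall>y\<in>S. \<exists>x. x \<in> T \<and> lin_ext \<phi> x = y" using surj S(1) by blast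
    from bchoice[OF this] show ?thesis using that by blast
  qed
  have inj: "inj_on g S" using g by (metis inj_onI)
  have sum_g: "(\<Sum>x\<in>g ` S. smul (c x) x) = (\<Sum>y\<in>S. smul (c (g y)) (g y))" for c
    by (simp add: sum.reindex[OF inj])
  have phi_g: "lin_ext \<phi> (\<Sum>y\<in>S. smul (c y) (g y)) = (\<Sum>y\<in>S. smul (c y) y)" for c
    by (simp add: lin_ext_sum lin_ext_smul g)
  have in_T: "(\<Sum>y\<in>S. smul (c y) (g y)) \<in> T" for c
    by (intro free_vs.subspace_sum free_vs.subspace_scale T) (use g in auto)
  have preimage: "free_vs.subspace {x \<in> T. lin_ext \<phi> x \<in> V}" if "free_vs.subspace V" for V
    using T that by (auto simp: free_vs.subspace_def lin_ext_add lin_ext_smul)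
  have "\<exists>c. z - (\<Sum>x\<in>g ` S. smul (c x) x) \<in> B" if z: "z \<in> Z" for z
  proof -
    have "lin_ext \<phi> z \<in> Z'" "z \<in> T" using z Z by auto
    then obtain c where c: "lin_ext \<phi> z - (\<Sum>x\<in>S. smul (c x) x) \<in> B'" using gen by blast
    have "(\<Sum>x\<in>g ` S. smul (c (lin_ext \<phi> x)) x) = (\<Sum>y\<in>S. smul (c y) (g y))"
      by (simp add: sum_g g)
    then have "z - (\<Sum>x\<in>g ` S. smul (c (lin_ext \<phi> x)) x) \<in> B"
      using c \<open>z \<in> T\<close> in_T T by (simp add: B lin_ext_diff phi_g free_vs.subspace_diff)
    then show ?thesis by (rule exI[where x = "\<lambda>x. c (lin_ext \<phi> x)"])
  qed
  moreover have "\<forall>x\<in>g ` S. c x = 0" if "(\<Sum>x\<in>g ` S. smul (c x) x) \<in> B" for c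
    using that ind[rule_format, of "\<lambda>y. c (g y)"] by (simp add: sum_g B phi_g[of "\<lambda>y. c (g y)"])
  moreover have "free_vs.subspace Z" "free_vs.subspace B"
    unfolding Z B using sub by (simp_all add: preimage)
  moreover have "B \<subseteq> Z" using sub(3) Z B by auto
  moreover have "g ` S \<subseteq> Z" using g S(1) by (auto simp: Z)
  ultimately show ?thesis
    unfolding quotient_has_dim_def using S(2,3) card_image[OF inj]
    by (intro conjI exI[where x = "g ` S"]) auto
qed

text \<open>The basis vectors indexed by \<open>E\<close> span a linear complement of
  \<open>B\<close> in \<open>Z\<close>: by \<open>gen\<close> the two spaces exhaust
  \<open>Z\<close>, by \<open>ind\<close> they meet in zero.\<close>

lemma quotient_has_dim_vec:
  assumes sub: "free_vs.subspace Z" "free_vs.subspace B" "B \<subseteq> Z"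
    and E: "finite E" "vec ` E \<subseteq> Z"
    and gen: "\<And>z. z \<in> Z \<Longrightarrow> \<exists>y\<in>B. Poly_Mapping.keys (z - y) \<subseteq> E"
    and ind: "\<And>x. x \<in> B \<Longrightarrow> Poly_Mapping.keys x \<subseteq> E \<Longrightarrow> x = 0"
  shows "quotient_has_dim Z (B :: ('b \<Rightarrow>\<^sub>0 'k::field) set) (card E)"
proof -
  let ?S = "vec ` E :: ('b \<Rightarrow>\<^sub>0 'k) set"
  have inj: "inj_on (vec :: 'b \<Rightarrow> 'b \<Rightarrow>\<^sub>0 'k) E"
    by (rule inj_onI) (metis keys_single singleton_inject zero_neq_one)
  have sum_S: "(\<Sum>x\<in>?S. smul (c x) x) = (\<Sum>e\<in>E. smul (c (vec e)) (vec e))" for c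
    by (simp add: sum.reindex[OF inj])
  have "\<forall>x\<in>?S. c x = 0" if "(\<Sum>x\<in>?S. smul (c x) x) \<in> B" for c
  proof -
    let ?x = "\<Sum>e\<in>E. smul (c (vec e)) (vec e)"
    have lookup: "Poly_Mapping.lookup ?x e = (if e \<in> E then c (vec e) else 0)" for e
      using E(1) by (simp add: lookup_sum lookup_smul lookup_single when_def
          if_distrib[of "(*) _"] cong: if_cong)
    then have "Poly_Mapping.keys ?x \<subseteq> E" by (auto simp: in_keys_iff split: if_splits)
    then have "?x = 0" using that ind by (simp add: sum_S)
    then have "c (vec e) = 0" if "e \<in> E" for e using lookup[of e] that by simp
    then show ?thesis by blast
  qed
  moreover have "\<exists>c. z - (\<Sum>x\<in>?S. smul (c x) x) \<in> B" if z: "z \<in> Z" for z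
  proof -
    obtain y where y: "y \<in> B" "Poly_Mapping.keys (z - y) \<subseteq> E" using gen z by blast
    \<comment> \<open>Coefficients are indexed by vectors rather than by \<open>E\<close>; the
      single key of \<open>vec e\<close> gives \<open>e\<close> back.\<close>
    define c :: "('b \<Rightarrow>\<^sub>0 'k) \<Rightarrow> 'k"
      where "c x = Poly_Mapping.lookup (z - y) (the_elem (Poly_Mapping.keys x))" for x
    have "z - y = lin_ext vec (z - y)" by (simp add: lin_ext_vec_id)
    also have "\<dots> = (\<Sum>x\<in>?S. smul (c x) x)"
      by (simp add: lin_ext_superset[OF E(1) y(2)] sum_S c_def)
    finally have "z - (\<Sum>x\<in>?S. smul (c x) x) = y" by (simp add: algebra_simps)
    then show ?thesis using y(1) by metis
  qed
  moreover have "finite ?S" "card ?S = card E" using E(1) inj by (simp_all add: card_image)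
  ultimately show ?thesis
    unfolding quotient_has_dim_def using sub E(2)
    by (intro conjI exI[where x = ?S]) auto
qed

lemma quotient_has_dim_self: "free_vs.subspace Z \<Longrightarrow> quotient_has_dim Z Z 0"
  unfolding quotient_has_dim_def by (auto intro!: exI[where x = "{}"])

section \<open>The complex of partial functions\<close>

text \<open>A partial function is stored as its set of pairs: grafting and closing up both become
  the insertion of one pair, and the function of a word is the union of the arc sets of its
  factors.\<close>

definition loopfree_funs :: "'v set \<Rightarrow> ('v \<times> 'v) set set" where
  "loopfree_funs I = {A. A \<subseteq> I \<times> I \<and> single_valued A \<and> (\<forall>x. (x, x) \<notin> A)}"

definition rootset :: "'v set \<Rightarrow> ('v \<times> 'v) set \<Rightarrow> 'v set" where
  "rootset I A = I - Domain A"

text \<open>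
  The Koszul sign of moving \<open>r\<close> to the front of the elements of \<open>S\<close>, listed in the order given by \<open>idx\<close>.
\<close>

definition eps :: "('v \<Rightarrow> nat) \<Rightarrow> 'v \<Rightarrow> 'v set \<Rightarrow> 'k::field_char_0" where
  "eps idx r S = (-1) ^ card {s \<in> S. idx s < idx r}"

lemma eps_mult_self [simp]: "eps idx r S * eps idx r S = (1 :: 'k::field_char_0)"
  by (simp add: eps_def flip: power_mult_distrib)

lemma eps_remove:
  assumes "finite S"
  shows "(eps idx r (S - {s}) :: 'k::field_char_0)
    = (if s \<in> S \<and> idx s < idx r then - eps idx r S else eps idx r S)"
proof (cases "s \<in> S \<and> idx s < idx r")
  case True
  let ?X = "{t \<in> S. idx t < idx r}"
  have "{t \<in> S - {s}. idx t < idx r} = ?X - {s}" by auto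
  moreover have "card ?X = Suc (card (?X - {s}))"
    using True assms by (intro card.remove) auto
  then have "(- 1 :: 'k) ^ card ?X = - ((- 1) ^ card (?X - {s}))" by simp
  ultimately have "eps idx r (S - {s}) = - ((- 1 :: 'k) ^ card ?X)"
    unfolding eps_def by simp
  then show ?thesis using True by (simp add: eps_def)
next
  case False
  then have "{t \<in> S - {s}. idx t < idx r} = {t \<in> S. idx t < idx r}" by auto
  then show ?thesis using False by (auto simp: eps_def)
qed

text \<open>Removing the element of smaller index flips the sign of the other one, and the reverse
  removal changes nothing. By injectivity of \<open>idx\<close>, exactly one of the two products
  picks up this flip.\<close>

lemma eps_anticommute:
  assumes "finite S" "inj_on idx S" "r \<in> S" "s \<in> S" "r \<noteq> s"
  shows "(eps idx r S * eps idx s (S - {r}) :: 'k::field_char_0) = - (eps idx s S * eps idx r (S - {s}))"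
proof -
  have "idx r \<noteq> idx s" using assms by (auto simp: inj_on_def)
  then show ?thesis using assms by (auto simp: eps_remove)
qed

text \<open>Exchanging the summation variables shows that the sum equals its own negative;
  characteristic zero allows division by 2, coefficient by coefficient.\<close>

lemma sum_antisymmetric:
  fixes g :: "'a \<Rightarrow> 'a \<Rightarrow> ('b \<Rightarrow>\<^sub>0 'k::field_char_0)"
  assumes "finite R" and anti: "\<And>r s. r \<in> R \<Longrightarrow> s \<in> R \<Longrightarrow> r \<noteq> s \<Longrightarrow> g r s = - g s r"
  shows "(\<Sum>r\<in>R. \<Sum>s\<in>R - {r}. g r s) = 0"
proof -
  let ?X = "\<Sum>r\<in>R. \<Sum>s\<in>R - {r}. g r s"
  have X: "?X = (\<Sum>r\<in>R. \<Sum>s\<in>{s \<in> R. r \<noteq> s}. g r s)"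
    by (intro sum.cong refl) auto
  also have "\<dots> = (\<Sum>s\<in>R. \<Sum>r\<in>{r \<in> R. r \<noteq> s}. g r s)"
    using assms(1) by (intro sum.swap_restrict)
  also have "\<dots> = (\<Sum>s\<in>R. \<Sum>r\<in>{r \<in> R. s \<noteq> r}. - g s r)"
    by (intro sum.cong anti refl) auto
  also have "\<dots> = - ?X" by (simp add: sum_negf X)
  finally have X0: "?X + ?X = 0"
    by (simp only: eq_neg_iff_add_eq_0)
  show ?thesis
  proof (rule poly_mapping_eqI)
    fix b
    have "2 * Poly_Mapping.lookup ?X b = Poly_Mapping.lookup (?X + ?X) b"
      by (simp only: lookup_add mult_2)
    also have "\<dots> = 0" by (simp only: X0 lookup_zero)
    finally show "Poly_Mapping.lookup ?X b = Poly_Mapping.lookup 0 b" by simp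
  qed
qed

lemma loopfree_funs_mono: "A \<in> loopfree_funs I \<Longrightarrow> B \<subseteq> A \<Longrightarrow> B \<in> loopfree_funs I"
  by (auto simp: loopfree_funs_def intro: single_valued_subset)

lemma loopfree_funs_insert:
  assumes "A \<in> loopfree_funs I" "r \<in> rootset I A" "v \<in> I - {r}"
  shows "insert (r, v) A \<in> loopfree_funs I"
  using assms by (auto simp: loopfree_funs_def rootset_def single_valued_def)

lemma rootset_insert: "rootset I (insert (r, v) A) = rootset I A - {r}"
  by (auto simp: rootset_def)

lemma rootset_remove:
  assumes "A \<in> loopfree_funs I" "(i, v) \<in> A"
  shows "rootset I (A - {(i, v)}) = insert i (rootset I A)"
  using assms by (auto simp: loopfree_funs_def rootset_def single_valued_def)

section \<open>The differential on functions, with signs from an enumeration of the labels\<close>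

locale enumerated_labels =
  fixes I :: "'v set" and idx :: "'v \<Rightarrow> nat"
  assumes finite_I: "finite I" and inj_idx: "inj_on idx I"
begin

lemma finite_rootset [simp]: "finite (rootset I A)"
  by (simp add: rootset_def finite_I)

lemma inj_idx_rootset: "inj_on idx (rootset I A)"
  using inj_idx by (rule inj_on_subset) (auto simp: rootset_def)

text \<open>This is the differential of the tensor product over \<open>I\<close>: the factor at an
  element is odd exactly when that element is a root, and the sign counts the odd factors passed on
  the way to \<open>r\<close>.\<close>

definition bd :: "('v \<times> 'v) set \<Rightarrow> (('v \<times> 'v) set \<Rightarrow>\<^sub>0 'k::field_char_0)" where
  "bd A = (\<Sum>r\<in>rootset I A. smul (eps idx r (rootset I A)) (\<Sum>v\<in>I - {r}. vec (insert (r, v) A)))"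

definition arrow_basis :: "int \<Rightarrow> ('v \<times> 'v) set set" where
  "arrow_basis k = {A \<in> loopfree_funs I. int (card (rootset I A)) = k}"

definition arrow_chains :: "int \<Rightarrow> (('v \<times> 'v) set \<Rightarrow>\<^sub>0 'k::field_char_0) set" where
  "arrow_chains k = {p. Poly_Mapping.keys p \<subseteq> arrow_basis k}"

lemma subspace_arrow_chains: "free_vs.subspace (arrow_chains k)"
  unfolding arrow_chains_def by (rule subspace_keys)

lemma insert_arrow_basis:
  assumes "A \<in> arrow_basis k" "r \<in> rootset I A" "v \<in> I - {r}"
  shows "insert (r, v) A \<in> arrow_basis (k - 1)"
proof -
  have "card (rootset I A) = Suc (card (rootset I A - {r}))"
    using assms(2) by (intro card.remove) auto
  then show ?thesis
    using assms loopfree_funs_insert[of A I r v] by (auto simp: arrow_basis_def rootset_insert)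
qed

lemma bd_arrow_chains: "A \<in> arrow_basis k \<Longrightarrow> bd A \<in> arrow_chains (k - 1)"
  unfolding bd_def
  by (intro free_vs.subspace_sum free_vs.subspace_scale subspace_arrow_chains)
    (auto simp: arrow_chains_def insert_arrow_basis)

lemma lin_ext_bd_arrow_chains: "p \<in> arrow_chains k \<Longrightarrow> lin_ext bd p \<in> arrow_chains (k - 1)"
  by (rule lin_ext_in_subspace[OF subspace_arrow_chains])
    (auto simp: arrow_chains_def[of k] intro: bd_arrow_chains)

text \<open>Applying the differential twice adds arrows out of two distinct roots. The order of
  insertion does not affect the function, but the signs of the two orders are opposite.\<close>

lemma bd_bd: "lin_ext bd (bd A) = (0 :: ('v \<times> 'v) set \<Rightarrow>\<^sub>0 'k::field_char_0)"
proof -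
  let ?R = "rootset I A"
  define g :: "'v \<Rightarrow> 'v \<Rightarrow> (('v \<times> 'v) set \<Rightarrow>\<^sub>0 'k)" where
    "g r s = smul (eps idx r ?R * eps idx s (?R - {r}))
       (\<Sum>v\<in>I - {r}. \<Sum>u\<in>I - {s}. vec (insert (s, u) (insert (r, v) A)))" for r s
  have "lin_ext bd (bd A) = (\<Sum>r\<in>?R. \<Sum>s\<in>?R - {r}. g r s)"
    unfolding bd_def[of A] lin_ext_sum lin_ext_smul lin_ext_vec
  proof (intro sum.cong refl)
    fix r
    have "(\<Sum>v\<in>I - {r}. bd (insert (r, v) A)) = (\<Sum>s\<in>?R - {r}. \<Sum>v\<in>I - {r}.
        smul (eps idx s (?R - {r})) (\<Sum>u\<in>I - {s}. vec (insert (s, u) (insert (r, v) A)) :: _ \<Rightarrow>\<^sub>0 'k))"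
      unfolding bd_def rootset_insert by (rule sum.swap)
    then show "smul (eps idx r ?R) (\<Sum>v\<in>I - {r}. bd (insert (r, v) A)) = (\<Sum>s\<in>?R - {r}. g r s)"
      by (simp add: g_def free_vs.scale_sum_right)
  qed
  also have "\<dots> = 0"
  proof (rule sum_antisymmetric)
    fix r s assume rs: "r \<in> ?R" "s \<in> ?R" "r \<noteq> s"
    have "(\<Sum>v\<in>I - {r}. \<Sum>u\<in>I - {s}. vec (insert (s, u) (insert (r, v) A)))
        = (\<Sum>u\<in>I - {s}. \<Sum>v\<in>I - {r}. (vec (insert (r, v) (insert (s, u) A)) :: _ \<Rightarrow>\<^sub>0 'k))"
      by (subst sum.swap) (simp add: insert_commute)
    then show "g r s = - g s r"
      unfolding g_def using eps_anticommute[OF finite_rootset inj_idx_rootset rs, where 'k = 'k]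
      by simp
  qed simp
  finally show ?thesis .
qed

lemma lin_ext_bd_bd: "lin_ext bd (lin_ext bd p) = 0"
  by (simp add: lin_ext_lin_ext bd_bd) (simp add: lin_ext_def)

text \<open>
  In the tensor factor at \<open>i\<close>, with degree \<open>1\<close> part spanned by a vector \<open>r\<close>, the map \<open>b i \<mapsto> r\<close>, \<open>v \<mapsto> 0\<close>
  for \<open>v \<noteq> b i\<close> is a homotopy between the identity and the projection that kills \<open>r\<close>, fixes all \<open>v \<noteq> b i\<close>
  and kills \<open>\<Sum>\<^sub>v v\<close>. As the differentials of different factors anticommute, this remains a homotopy for
  the total differential.
\<close>

definition base_homotopy :: "('v \<Rightarrow> 'v) \<Rightarrow> 'v \<Rightarrow> ('v \<times> 'v) set \<Rightarrow> (('v \<times> 'v) set \<Rightarrow>\<^sub>0 'k::field_char_0)" where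
  "base_homotopy b i A = (if (i, b i) \<in> A
     then smul (eps idx i (rootset I (A - {(i, b i)}))) (vec (A - {(i, b i)})) else 0)"

definition base_proj :: "('v \<Rightarrow> 'v) \<Rightarrow> 'v \<Rightarrow> ('v \<times> 'v) set \<Rightarrow> (('v \<times> 'v) set \<Rightarrow>\<^sub>0 'k::field_char_0)" where
  "base_proj b i A = (if i \<notin> Domain A then 0
     else if (i, b i) \<in> A then - (\<Sum>v\<in>I - {i, b i}. vec (insert (i, v) (A - {(i, b i)})))
     else vec A)"

text \<open>If \<open>i\<close> is a root, only a new arrow from \<open>i\<close> to
  \<open>b i\<close> can be undone, which gives \<open>A\<close> back. If \<open>i\<close> points to
  \<open>b i\<close>, the terms at all other roots cancel by anticommutation and those at
  \<open>i\<close> remain. If \<open>i\<close> points elsewhere, the homotopy vanishes on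
  \<open>A\<close> and on every term of \<open>bd A\<close>.\<close>

lemma base_homotopy_eq:
  assumes A: "A \<in> loopfree_funs I" and i: "i \<in> I" "b i \<in> I - {i}"
  shows "lin_ext bd (base_homotopy b i A) + lin_ext (base_homotopy b i) (bd A)
    = (vec A - base_proj b i A :: _ \<Rightarrow>\<^sub>0 'k::field_char_0)"
proof -
  let ?R = "rootset I A" and ?h = "base_homotopy b i :: _ \<Rightarrow> _ \<Rightarrow>\<^sub>0 'k"
  have sv: "v = b i" if "(i, v) \<in> A" "(i, b i) \<in> A" for v
    using A that by (auto simp: loopfree_funs_def single_valued_def)
  have hbd: "lin_ext ?h (bd A) = (\<Sum>r\<in>?R. smul (eps idx r ?R) (\<Sum>v\<in>I - {r}. ?h (insert (r, v) A)))"
    unfolding bd_def by (simp add: lin_ext_sum lin_ext_smul)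
  consider "i \<notin> Domain A" | "(i, b i) \<in> A" | "i \<in> Domain A" "(i, b i) \<notin> A" by blast
  then show ?thesis
  proof cases
    case 1
    then have iR: "i \<in> ?R" using i by (simp add: rootset_def)
    have h: "?h (insert (r, v) A) = (if r = i \<and> v = b i then smul (eps idx i ?R) (vec A) else 0)" for r v
    proof -
      have "A - {(i, b i)} = A" using 1 by auto
      then show ?thesis using 1 by (auto simp: base_homotopy_def)
    qed
    have "(\<Sum>v\<in>I - {r}. ?h (insert (r, v) A)) = (if r = i then smul (eps idx i ?R) (vec A) else 0)" for r
      using i finite_I by (auto simp: h)
    then have "lin_ext ?h (bd A)
        = (\<Sum>r\<in>?R. if r = i then smul (eps idx r ?R) (smul (eps idx i ?R) (vec A)) else 0)"
      unfolding hbd by (intro sum.cong) auto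
    also have "\<dots> = vec A" using iR by simp
    finally show ?thesis using 1 by (auto simp: base_homotopy_def base_proj_def)
  next
    case 2
    define B where "B = A - {(i, b i)}"
    have iR: "i \<notin> ?R" using 2 by (auto simp: rootset_def)
    have RB: "rootset I B = insert i ?R" unfolding B_def using rootset_remove[OF A 2] .
    \<comment> \<open>The left side is the sign of undoing the arrow at \<open>i\<close> before
      adding one at \<open>r\<close>, the right side belongs to the opposite order.\<close>
    have anti: "eps idx i (insert i ?R) * eps idx r (insert i ?R)
        = - (eps idx r ?R * eps idx i (insert i ?R - {r}) :: 'k)" if "r \<in> ?R" for r
    proof -
      have "idx r \<noteq> idx i" using inj_idx that i iR by (auto simp: inj_on_def rootset_def)
      moreover have "?R = insert i ?R - {i}" using iR by auto
      ultimately show ?thesis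
        using that iR eps_remove[of "insert i ?R" idx i r, where 'k = 'k]
          eps_remove[of "insert i ?R" idx r i, where 'k = 'k] by auto
    qed
    define f where "f r = (\<Sum>v\<in>I - {r}. vec (insert (r, v) B) :: _ \<Rightarrow>\<^sub>0 'k)" for r
    have "lin_ext bd (?h A) = smul (eps idx i (insert i ?R)) (bd B)"
      using 2 by (simp add: base_homotopy_def lin_ext_smul B_def[symmetric] RB)
    also have "bd B = (\<Sum>r\<in>insert i ?R. smul (eps idx r (insert i ?R)) (f r))"
      by (simp add: bd_def RB f_def)
    also have "smul (eps idx i (insert i ?R)) \<dots> = f i
        + (\<Sum>r\<in>?R. smul (eps idx i (insert i ?R) * eps idx r (insert i ?R)) (f r))"
      using iR by (simp add: free_vs.scale_right_distrib free_vs.scale_sum_right)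
    also have "(\<Sum>r\<in>?R. smul (eps idx i (insert i ?R) * eps idx r (insert i ?R)) (f r))
        = - (\<Sum>r\<in>?R. smul (eps idx r ?R * eps idx i (insert i ?R - {r})) (f r))"
      unfolding sum_negf[symmetric] by (intro sum.cong refl) (simp add: anti)
    also have "(\<Sum>r\<in>?R. smul (eps idx r ?R * eps idx i (insert i ?R - {r})) (f r)) = lin_ext ?h (bd A)"
      unfolding hbd
    proof (intro sum.cong refl)
      fix r assume r: "r \<in> ?R"
      have "?h (insert (r, v) A) = smul (eps idx i (insert i ?R - {r})) (vec (insert (r, v) B))" for v
      proof -
        have "insert (r, v) A - {(i, b i)} = insert (r, v) B" using r iR by (auto simp: B_def)
        then show ?thesis using 2 by (simp add: base_homotopy_def rootset_insert RB)
      qed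
      then show "smul (eps idx r ?R * eps idx i (insert i ?R - {r})) (f r)
          = smul (eps idx r ?R) (\<Sum>v\<in>I - {r}. ?h (insert (r, v) A))"
        by (simp add: f_def free_vs.scale_sum_right)
    qed
    finally have "lin_ext bd (?h A) + lin_ext ?h (bd A) = f i" by simp
    \<comment> \<open>Splitting off the target \<open>b i\<close> recovers \<open>A\<close>; the
      other arrows out of \<open>i\<close> are the correction in \<open>base_proj\<close>.\<close>
    moreover have "f i = vec A - base_proj b i A"
    proof -
      have "I - {i} = insert (b i) (I - {i, b i})" using i by auto
      then have "f i = vec (insert (i, b i) B) + (\<Sum>v\<in>I - {i, b i}. vec (insert (i, v) B))"
        unfolding f_def using finite_I by (simp add: sum.insert_remove)
      moreover have "insert (i, b i) B = A" using 2 by (auto simp: B_def)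
      ultimately show ?thesis using 2 by (auto simp: base_proj_def B_def)
    qed
    ultimately show ?thesis by simp
  next
    case 3
    have "?h (insert (r, v) A) = 0" if "r \<in> ?R" for r v
      using that 3 by (auto simp: base_homotopy_def rootset_def)
    then have "lin_ext ?h (bd A) = 0" unfolding hbd by simp
    then show ?thesis using 3 by (simp add: base_homotopy_def base_proj_def)
  qed
qed

lemma base_homotopy_arrow_chains:
  assumes "A \<in> arrow_basis k" "i \<in> I"
  shows "base_homotopy b i A \<in> arrow_chains (k + 1)"
proof (cases "(i, b i) \<in> A")
  case True
  have A: "A \<in> loopfree_funs I" using assms by (simp add: arrow_basis_def)
  have "i \<notin> rootset I A" using True by (auto simp: rootset_def)
  then have "A - {(i, b i)} \<in> arrow_basis (k + 1)"
    using assms True loopfree_funs_mono[OF A, of "A - {(i, b i)}"]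
    by (auto simp: arrow_basis_def rootset_remove[OF A])
  then have "vec (A - {(i, b i)}) \<in> arrow_chains (k + 1)" by (simp add: arrow_chains_def)
  then show ?thesis
    by (auto simp: base_homotopy_def
        intro: free_vs.subspace_scale free_vs.subspace_0 subspace_arrow_chains)
qed (simp add: base_homotopy_def free_vs.subspace_0 subspace_arrow_chains)

text \<open>With base values \<open>b i \<in> I - {i}\<close>, the set for \<open>J = I\<close> and
  \<open>k = 0\<close> indexes a basis of the homology. Smaller \<open>J\<close> are the
  intermediate stages, reached once the projections for the elements of \<open>J\<close> have been
  applied.\<close>

definition off_base :: "('v \<Rightarrow> 'v) \<Rightarrow> 'v set \<Rightarrow> int \<Rightarrow> ('v \<times> 'v) set set" where
  "off_base b J k = {A \<in> arrow_basis k. \<forall>j\<in>J. j \<in> Domain A \<and> (j, b j) \<notin> A}"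

text \<open>Only the arrow out of \<open>i\<close> is redirected, so the conditions at elements of
  \<open>J\<close> survive, and the number of roots stays the same because the deleted arrow is
  replaced by another.\<close>

lemma base_proj_off_base:
  assumes A: "A \<in> off_base b J k" and i: "i \<in> I"
  shows "Poly_Mapping.keys (base_proj b i A :: _ \<Rightarrow>\<^sub>0 'k::field_char_0) \<subseteq> off_base b (insert i J) k"
proof -
  have lf: "A \<in> loopfree_funs I" and k: "int (card (rootset I A)) = k"
    using A by (auto simp: off_base_def arrow_basis_def)
  let ?V = "{p :: _ \<Rightarrow>\<^sub>0 'k. Poly_Mapping.keys p \<subseteq> off_base b (insert i J) k}"
  consider "i \<notin> Domain A" | "(i, b i) \<in> A" | "i \<in> Domain A" "(i, b i) \<notin> A" by blast
  then have "base_proj b i A \<in> ?V"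
  proof cases
    case 2
    define B where "B = A - {(i, b i)}"
    have "B \<in> loopfree_funs I" using loopfree_funs_mono[OF lf] by (auto simp: B_def)
    moreover have RB: "rootset I B = insert i (rootset I A)"
      unfolding B_def using rootset_remove[OF lf 2] .
    moreover have "i \<notin> rootset I A" "i \<notin> Domain B"
      using 2 lf by (auto simp: rootset_def B_def loopfree_funs_def single_valued_def)
    ultimately have "insert (i, v) B \<in> off_base b (insert i J) k" if "v \<in> I - {i, b i}" for v
      using that A 2 k loopfree_funs_insert[of B I i v]
      by (auto simp: off_base_def arrow_basis_def rootset_insert B_def)
    then have "- (\<Sum>v\<in>I - {i, b i}. vec (insert (i, v) B)) \<in> ?V"
      by (intro free_vs.subspace_neg free_vs.subspace_sum subspace_keys) auto
    then show ?thesis using 2 by (auto simp: base_proj_def B_def)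
  qed (use A in \<open>auto simp: base_proj_def off_base_def\<close>)
  then show ?thesis by simp
qed

section \<open>Reducing cycles and boundaries by the homotopies\<close>

lemma lin_ext_base_homotopy:
  assumes p: "p \<in> arrow_chains k" and i: "i \<in> I" "b i \<in> I - {i}"
  shows "lin_ext bd (lin_ext (base_homotopy b i) p) + lin_ext (base_homotopy b i) (lin_ext bd p)
    = p - lin_ext (base_proj b i) p"
proof -
  have "lin_ext bd (lin_ext (base_homotopy b i) p) + lin_ext (base_homotopy b i) (lin_ext bd p)
    = lin_ext (\<lambda>A. vec A - base_proj b i A) p"
    unfolding lin_ext_lin_ext lin_ext_add_fun[symmetric]
    by (rule lin_ext_cong) (use p base_homotopy_eq[of _ i b, OF _ i] in \<open>auto simp: arrow_chains_def arrow_basis_def\<close>)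
  then show ?thesis by (simp add: lin_ext_diff_fun lin_ext_vec_id)
qed

lemma lin_ext_base_homotopy_arrow_chains:
  "p \<in> arrow_chains k \<Longrightarrow> i \<in> I \<Longrightarrow> lin_ext (base_homotopy b i) p \<in> arrow_chains (k + 1)"
  by (rule lin_ext_in_subspace[OF subspace_arrow_chains])
    (auto simp: arrow_chains_def[of k] intro: base_homotopy_arrow_chains)

lemma lin_ext_base_proj_off_base:
  assumes "Poly_Mapping.keys p \<subseteq> off_base b J k" "i \<in> I"
  shows "Poly_Mapping.keys (lin_ext (base_proj b i) p) \<subseteq> off_base b (insert i J) k"
proof -
  have "lin_ext (base_proj b i) p \<in> {p. Poly_Mapping.keys p \<subseteq> off_base b (insert i J) k}"
    using assms base_proj_off_base
    by (intro lin_ext_in_subspace subspace_keys) blast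
  then show ?thesis by simp
qed

lemma off_base_empty: "off_base b {} k = arrow_basis k"
  by (simp add: off_base_def)

lemma off_base_subset: "off_base b J k \<subseteq> arrow_basis k"
  by (auto simp: off_base_def)

text \<open>A function with a value at every element of \<open>I\<close> has no roots and sits in
  degree 0. This is the source of the vanishing in other degrees when \<open>I\<close> has at least
  two elements.\<close>

lemma off_base_eq_empty: "k \<noteq> 0 \<Longrightarrow> off_base b I k = {}"
proof (rule ccontr)
  assume "k \<noteq> 0" "off_base b I k \<noteq> {}"
  then obtain A where "A \<in> off_base b I k" by blast
  then have "rootset I A = {}" "int (card (rootset I A)) = k"
    by (auto simp: off_base_def rootset_def arrow_basis_def)
  then show False using \<open>k \<noteq> 0\<close> by simp
qed

text \<open>On a cycle the homotopy identity says that the projection at \<open>i\<close> changes it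
  only by a boundary. Applying the projections for all elements of \<open>J\<close> moves the cycle
  onto \<open>off_base\<close> within its homology class.\<close>

lemma arrow_cycle_reduce:
  assumes b: "\<And>i. i \<in> I \<Longrightarrow> b i \<in> I - {i}" and z: "z \<in> arrow_chains k" "lin_ext bd z = 0"
    and J: "J \<subseteq> I"
  shows "\<exists>y\<in>arrow_chains (k + 1). Poly_Mapping.keys (z - lin_ext bd y) \<subseteq> off_base b J k"
  using finite_subset[OF J finite_I] J
proof (induction J rule: finite_induct)
  case empty
  then show ?case
    using z by (intro bexI[of _ 0])
      (auto simp: off_base_empty arrow_chains_def)
next
  case (insert i J)
  then obtain y where y: "y \<in> arrow_chains (k + 1)"
    and keys: "Poly_Mapping.keys (z - lin_ext bd y) \<subseteq> off_base b J k" by auto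
  let ?z = "z - lin_ext bd y"
  have i: "i \<in> I" using insert by simp
  have zc: "?z \<in> arrow_chains k"
    using order_trans[OF keys off_base_subset] by (simp add: arrow_chains_def)
  have "lin_ext bd ?z = 0" by (simp add: lin_ext_diff lin_ext_bd_bd z)
  then have "?z - lin_ext bd (lin_ext (base_homotopy b i) ?z) = lin_ext (base_proj b i) ?z"
    using lin_ext_base_homotopy[where b = b and i = i, OF zc i b[OF i]] by (simp add: algebra_simps)
  then have "z - lin_ext bd (y + lin_ext (base_homotopy b i) ?z) = lin_ext (base_proj b i) ?z"
    by (simp add: lin_ext_add algebra_simps)
  moreover have "Poly_Mapping.keys (lin_ext (base_proj b i) ?z) \<subseteq> off_base b (insert i J) k"
    using keys i by (rule lin_ext_base_proj_off_base)
  moreover have "y + lin_ext (base_homotopy b i) ?z \<in> arrow_chains (k + 1)"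
    using y zc i by (intro free_vs.subspace_add subspace_arrow_chains lin_ext_base_homotopy_arrow_chains)
  ultimately show ?case by metis
qed

text \<open>Each projection fixes the given boundary and commutes with the differential, so the
  bounding chain may be replaced by its image under all projections. That image is a combination of
  total functions of degree 1, of which there are none, so it is zero.\<close>

lemma off_base_boundary_eq_0:
  assumes b: "\<And>i. i \<in> I \<Longrightarrow> b i \<in> I - {i}" and y: "y \<in> arrow_chains 1"
    and x: "Poly_Mapping.keys (lin_ext bd y) \<subseteq> off_base b I 0"
  shows "lin_ext bd y = 0"
proof -
  have "\<exists>y'. Poly_Mapping.keys y' \<subseteq> off_base b J 1 \<and> lin_ext bd y' = lin_ext bd y"
    if J: "J \<subseteq> I" for J
    using finite_subset[OF J finite_I] J
  proof (induction J rule: finite_induct)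
    case empty
    then show ?case using y by (auto simp: off_base_empty arrow_chains_def)
  next
    case (insert i J)
    then obtain y' where y': "Poly_Mapping.keys y' \<subseteq> off_base b J 1" "lin_ext bd y' = lin_ext bd y"
      by auto
    have i: "i \<in> I" using insert by simp
    let ?h = "lin_ext (base_homotopy b i)" and ?P = "lin_ext (base_proj b i)"
    have c: "y' \<in> arrow_chains 1" using order_trans[OF y'(1) off_base_subset] by (simp add: arrow_chains_def)
    \<comment> \<open>Every function occurring in the boundary has a value at \<open>i\<close> other
      than \<open>b i\<close>, and \<open>base_proj\<close> fixes such functions.\<close>
    have "?P (lin_ext bd y) = lin_ext vec (lin_ext bd y)"
      using x i by (intro lin_ext_cong) (auto simp: off_base_def base_proj_def)
    then have Px: "?P (lin_ext bd y) = lin_ext bd y" by (simp add: lin_ext_vec_id)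
    have 1: "?P y' = y' - (lin_ext bd (?h y') + ?h (lin_ext bd y'))"
      using lin_ext_base_homotopy[where b = b and i = i, OF c i b[OF i]] by (simp add: algebra_simps)
    \<comment> \<open>The homotopy identity in degrees 1 and 0, with \<open>bd\<close> squaring to
      zero, brings both composites of projection and differential into the same form.\<close>
    have "lin_ext bd (?P y') = lin_ext bd y' - lin_ext bd (?h (lin_ext bd y'))"
      unfolding 1 by (simp add: lin_ext_diff lin_ext_add lin_ext_bd_bd)
    also have "\<dots> = ?P (lin_ext bd y')"
      using lin_ext_base_homotopy[where b = b and i = i, OF lin_ext_bd_arrow_chains[OF c] i b[OF i]]
      by (simp add: lin_ext_bd_bd algebra_simps)
    finally have "lin_ext bd (?P y') = lin_ext bd y" by (simp add: y' Px)
    then show ?case using lin_ext_base_proj_off_base[OF y'(1) i] by blast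
  qed
  from this[OF order_refl] show ?thesis by (auto simp: off_base_eq_empty)
qed

lemma finite_loopfree_funs: "finite (loopfree_funs I)"
  by (rule finite_subset[of _ "Pow (I \<times> I)"]) (auto simp: loopfree_funs_def finite_I)

text \<open>An element of degree 0 is the graph of a choice, at each \<open>i\<close>, of a value
  other than \<open>i\<close> and \<open>b i\<close>. These two are distinct elements of
  \<open>I\<close>, so \<open>card I - 2\<close> values are allowed.\<close>

lemma card_off_base:
  assumes b: "\<And>i. i \<in> I \<Longrightarrow> b i \<in> I - {i}"
  shows "card (off_base b I 0) = (card I - 2) ^ card I"
proof -
  let ?F = "Pi\<^sub>E I (\<lambda>i. I - {i, b i})" and ?g = "\<lambda>f. (\<lambda>i. (i, f i)) ` I"
  have inj: "inj_on ?g ?F"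
  proof (rule inj_onI)
    fix f f' assume f: "f \<in> ?F" "f' \<in> ?F" and eq: "?g f = ?g f'"
    show "f = f'"
    proof (rule PiE_ext[OF f])
      fix i assume "i \<in> I"
      then have "(i, f i) \<in> ?g f'" unfolding eq[symmetric] by blast
      then show "f i = f' i" by auto
    qed
  qed
  have img: "?g ` ?F = off_base b I 0"
  proof
    show "?g ` ?F \<subseteq> off_base b I 0"
    proof
      fix A assume "A \<in> ?g ` ?F"
      then obtain f where f: "f \<in> ?F" "A = ?g f" by blast
      then have "f i \<in> I \<and> i \<noteq> f i \<and> b i \<noteq> f i" if "i \<in> I" for i
        using that by (fastforce simp: PiE_iff)
      moreover have "Domain A = I" unfolding f(2) by force
      ultimately show "A \<in> off_base b I 0"
        unfolding f(2)
        by (auto simp: off_base_def arrow_basis_def loopfree_funs_def rootset_def single_valued_def)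
    qed
    show "off_base b I 0 \<subseteq> ?g ` ?F"
    proof
      fix A assume A: "A \<in> off_base b I 0"
      then have lf: "A \<subseteq> I \<times> I" "single_valued A" "\<And>x. (x, x) \<notin> A"
        and dom: "\<And>i. i \<in> I \<Longrightarrow> i \<in> Domain A \<and> (i, b i) \<notin> A"
        by (auto simp: off_base_def arrow_basis_def loopfree_funs_def)
      define f where "f = restrict (\<lambda>i. SOME v. (i, v) \<in> A) I"
      have f: "(i, f i) \<in> A" if "i \<in> I" for i
        using dom[OF that] that by (auto simp: f_def intro: someI)
      have "?g f = A"
      proof
        show "?g f \<subseteq> A" using f by blast
        show "A \<subseteq> ?g f"
        proof (rule subrelI)
          fix i v assume iv: "(i, v) \<in> A"
          then have "i \<in> I" using lf(1) by blast
          moreover have "f i = v" using f[OF \<open>i \<in> I\<close>] iv lf(2) by (auto dest: single_valuedD)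
          ultimately show "(i, v) \<in> ?g f" by blast
        qed
      qed
      moreover have "f i \<in> I - {i, b i}" if "i \<in> I" for i
        using f[OF that] lf dom[OF that] by auto
      then have "f \<in> ?F" by (auto simp: PiE_iff f_def)
      ultimately show "A \<in> ?g ` ?F" by blast
    qed
  qed
  have "card (off_base b I 0) = card ?F" unfolding img[symmetric] by (rule card_image[OF inj])
  also have "\<dots> = (\<Prod>i\<in>I. card (I - {i, b i}))" by (rule card_PiE[OF finite_I])
  also have "\<dots> = (\<Prod>i\<in>I. card I - 2)"
  proof (intro prod.cong refl)
    fix i assume i: "i \<in> I"
    then have "card (I - {i, b i}) = card I - card {i, b i}"
      using b[OF i] by (intro card_Diff_subset) auto
    moreover have "card {i, b i} = 2" using b[OF i] by auto
    ultimately show "card (I - {i, b i}) = card I - 2" by simp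
  qed
  finally show ?thesis by simp
qed

section \<open>Homology of the complex of functions\<close>

definition arrow_cycles :: "int \<Rightarrow> (('v \<times> 'v) set \<Rightarrow>\<^sub>0 'k::field_char_0) set" where
  "arrow_cycles k = {z \<in> arrow_chains k. lin_ext bd z = 0}"

definition arrow_boundaries :: "int \<Rightarrow> (('v \<times> 'v) set \<Rightarrow>\<^sub>0 'k::field_char_0) set" where
  "arrow_boundaries k = lin_ext bd ` arrow_chains (k + 1)"

lemma subspace_arrow_cycles: "free_vs.subspace (arrow_cycles k)"
  using subspace_arrow_chains[of k]
  by (auto simp: free_vs.subspace_def arrow_cycles_def lin_ext_add lin_ext_smul)

lemma subspace_arrow_boundaries: "free_vs.subspace (arrow_boundaries k :: (_ \<Rightarrow>\<^sub>0 'k::field_char_0) set)"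
  unfolding arrow_boundaries_def
proof (rule free_vs.subspaceI)
  have ch: "free_vs.subspace (arrow_chains (k + 1) :: (_ \<Rightarrow>\<^sub>0 'k) set)"
    by (rule subspace_arrow_chains)
  show "0 \<in> lin_ext bd ` (arrow_chains (k + 1) :: (_ \<Rightarrow>\<^sub>0 'k) set)"
    using free_vs.subspace_0[OF ch] by (intro image_eqI[of _ _ 0]) auto
  fix x y :: "_ \<Rightarrow>\<^sub>0 'k" and c
  assume "x \<in> lin_ext bd ` arrow_chains (k + 1)"
  then obtain p where p: "p \<in> arrow_chains (k + 1)" "x = lin_ext bd p" by blast
  show "smul c x \<in> lin_ext bd ` arrow_chains (k + 1)"
    using p free_vs.subspace_scale[OF ch p(1)] by (auto simp flip: lin_ext_smul)
  assume "y \<in> lin_ext bd ` arrow_chains (k + 1)"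
  then obtain q where q: "q \<in> arrow_chains (k + 1)" "y = lin_ext bd q" by blast
  show "x + y \<in> lin_ext bd ` arrow_chains (k + 1)"
    using p q free_vs.subspace_add[OF ch p(1) q(1)] by (auto simp flip: lin_ext_add)
qed

lemma arrow_boundaries_subset: "arrow_boundaries k \<subseteq> arrow_cycles k"
  using lin_ext_bd_arrow_chains[of _ "k + 1"]
  by (auto simp: arrow_boundaries_def arrow_cycles_def lin_ext_bd_bd)

text \<open>Two elements suffice to provide a base value \<open>b i \<noteq> i\<close> at every
  \<open>i\<close>. The functions in \<open>off_base b I k\<close> are cycles for lack of roots,
  generate because cycles can be reduced to them, and are independent because no nonzero boundary is
  supported on them.\<close>

lemma quotient_has_dim_arrow:
  assumes "card I \<ge> 2"
  shows "quotient_has_dim (arrow_cycles k :: (_ \<Rightarrow>\<^sub>0 'k::field_char_0) set) (arrow_boundaries k)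
    (if k = 0 then (card I - 2) ^ card I else 0)"
proof -
  have "\<exists>b. b \<in> I - {i}" if i: "i \<in> I" for i
  proof -
    have "card (I - {i}) \<noteq> 0" using assms i finite_I by simp
    then show ?thesis by (metis card.empty ex_in_conv)
  qed
  then obtain b where b: "\<And>i. i \<in> I \<Longrightarrow> b i \<in> I - {i}" by metis
  let ?E = "off_base b I k"
  have "quotient_has_dim (arrow_cycles k :: (_ \<Rightarrow>\<^sub>0 'k::field_char_0) set) (arrow_boundaries k) (card ?E)"
  proof (rule quotient_has_dim_vec)
    show "finite ?E"
      by (rule finite_subset[OF _ finite_loopfree_funs]) (auto simp: off_base_def arrow_basis_def)
    show "vec ` ?E \<subseteq> (arrow_cycles k :: (_ \<Rightarrow>\<^sub>0 'k) set)"
    proof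
      fix x :: "_ \<Rightarrow>\<^sub>0 'k" assume "x \<in> vec ` ?E"
      then obtain A where A: "A \<in> ?E" "x = vec A" by blast
      then have "rootset I A = {}" by (auto simp: off_base_def rootset_def)
      then have "bd A = (0 :: _ \<Rightarrow>\<^sub>0 'k)" by (simp add: bd_def)
      then show "x \<in> arrow_cycles k"
        using A off_base_subset by (auto simp: arrow_cycles_def arrow_chains_def)
    qed
    show "\<exists>y\<in>arrow_boundaries k. Poly_Mapping.keys (z - y) \<subseteq> ?E"
      if "z \<in> arrow_cycles k" for z :: "_ \<Rightarrow>\<^sub>0 'k"
      using that arrow_cycle_reduce[OF b, of z k I] by (auto simp: arrow_cycles_def arrow_boundaries_def)
    show "x = 0" if "x \<in> arrow_boundaries k" "Poly_Mapping.keys x \<subseteq> ?E" for x :: "_ \<Rightarrow>\<^sub>0 'k"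
    proof (cases "k = 0")
      case True
      then show ?thesis using that off_base_boundary_eq_0[OF b] by (auto simp: arrow_boundaries_def)
    next
      case False
      then show ?thesis using that by (auto simp: off_base_eq_empty)
    qed
  qed (rule subspace_arrow_cycles subspace_arrow_boundaries arrow_boundaries_subset)+
  moreover have "card ?E = (if k = 0 then (card I - 2) ^ card I else 0)"
    using card_off_base[OF b] off_base_eq_empty[of k b] by auto
  ultimately show ?thesis by simp
qed

text \<open>No base value exists here. The empty function is the only one and its root has nowhere
  to point, so the differential vanishes and the complex is its own homology.\<close>

lemma quotient_has_dim_arrow_singleton:
  assumes "card I = 1"
  shows "quotient_has_dim (arrow_cycles k :: (_ \<Rightarrow>\<^sub>0 'k::field_char_0) set) (arrow_boundaries k)
    (if k = 1 then 1 else 0)"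
proof -
  obtain a where I: "I = {a}" using assms card_1_singletonE by blast
  have lf: "loopfree_funs I = {{}}" unfolding I loopfree_funs_def by auto
  have basis: "arrow_basis k = (if k = 1 then {{}} else {})" for k
    unfolding arrow_basis_def lf by (auto simp: rootset_def I)
  have "bd {} = (0 :: _ \<Rightarrow>\<^sub>0 'k)" unfolding bd_def by (intro sum.neutral) (auto simp: I rootset_def)
  then have bd0: "lin_ext bd p = 0" if "p \<in> arrow_chains k" for p :: "_ \<Rightarrow>\<^sub>0 'k" and k
    using that by (auto simp: lin_ext_def arrow_chains_def basis intro!: sum.neutral split: if_splits)
  have "quotient_has_dim (arrow_cycles k :: (_ \<Rightarrow>\<^sub>0 'k) set) (arrow_boundaries k) (card (arrow_basis k))"
  proof (rule quotient_has_dim_vec)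
    show "finite (arrow_basis k)" by (simp add: basis)
    show "vec ` arrow_basis k \<subseteq> (arrow_cycles k :: (_ \<Rightarrow>\<^sub>0 'k) set)"
      using bd0[of "vec _" k] by (auto simp: arrow_cycles_def arrow_chains_def)
    show "\<exists>y\<in>arrow_boundaries k. Poly_Mapping.keys (z - y) \<subseteq> arrow_basis k"
      if "z \<in> arrow_cycles k" for z :: "_ \<Rightarrow>\<^sub>0 'k"
      using that free_vs.subspace_0[OF subspace_arrow_boundaries]
      by (intro bexI[of _ 0]) (auto simp: arrow_cycles_def arrow_chains_def)
    show "x = 0" if "x \<in> arrow_boundaries k" for x :: "_ \<Rightarrow>\<^sub>0 'k"
      using that bd0 by (auto simp: arrow_boundaries_def)
  qed (rule subspace_arrow_cycles subspace_arrow_boundaries arrow_boundaries_subset)+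
  moreover have "card (arrow_basis k) = (if k = 1 then 1 else 0)" by (simp add: basis)
  ultimately show ?thesis by simp
qed

end

section \<open>Rooted trees and cycles as connected loop-free functional graphs\<close>

text \<open>
  Rooted trees are the graphs of this kind that have a vertex without outgoing edge; the others are
  the directed cycles of rooted trees with a cycle of length at least two.
\<close>

definition comp_graph :: "'v pair_pre_digraph \<Rightarrow> bool" where
  "comp_graph G \<longleftrightarrow> finite (pverts G) \<and> pverts G \<noteq> {} \<and> parcs G \<in> loopfree_funs (pverts G) \<and>
     (\<forall>u\<in>pverts G. \<forall>v\<in>pverts G. (u, v) \<in> (parcs G \<union> (parcs G)\<inverse>)\<^sup>*)"

lemma comp_graph_induct:
  assumes "comp_graph G" "a \<in> pverts G" "P a" "\<And>x y. (x, y) \<in> parcs G \<Longrightarrow> P x \<longleftrightarrow> P y"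
    and v: "v \<in> pverts G"
  shows "P v"
proof -
  have "(a, v) \<in> (parcs G \<union> (parcs G)\<inverse>)\<^sup>*" using assms by (simp add: comp_graph_def)
  then show ?thesis by (induction rule: rtrancl_induct) (use assms in auto)
qed

lemma rtrancl_single_valued_step:
  assumes "single_valued A" "(x, r) \<in> A\<^sup>*" "(x, y) \<in> A" "x \<noteq> r"
  shows "(y, r) \<in> A\<^sup>*"
  using assms(2) by (rule converse_rtranclE) (use assms in \<open>auto simp: single_valued_def\<close>)

text \<open>Reaching \<open>r\<close> is invariant along arcs in both directions, since a path to
  \<open>r\<close> from another vertex must begin with the unique arc out of that vertex.
  Connectedness spreads this from \<open>r\<close> to all vertices.\<close>

lemma comp_graph_reaches:
  assumes G: "comp_graph G" and r: "r \<in> pverts G" "\<And>y. (r, y) \<in> parcs G \<Longrightarrow> y = r"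
    and v: "v \<in> pverts G"
  shows "(v, r) \<in> (parcs G)\<^sup>*"
proof (rule comp_graph_induct[OF G r(1) _ _ v])
  fix x y assume xy: "(x, y) \<in> parcs G"
  have "single_valued (parcs G)" using G by (simp add: comp_graph_def loopfree_funs_def)
  then show "(x, r) \<in> (parcs G)\<^sup>* \<longleftrightarrow> (y, r) \<in> (parcs G)\<^sup>*"
    using xy r(2) rtrancl_single_valued_step by (metis converse_rtrancl_into_rtrancl)
qed simp

section \<open>Digraph notions as statements about relations\<close>

lemma out_degree_parcs:
  "out_degree (with_proj G) v = card {e \<in> parcs G. fst e = v}"
  by (simp add: out_degree_def out_arcs_def)

lemma out_degree_eq_0:
  "finite (parcs G) \<Longrightarrow> out_degree (with_proj G) v = 0 \<longleftrightarrow> v \<notin> Domain (parcs G)"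
  by (auto simp: out_degree_parcs Domain_iff split_paired_All)

lemma out_degree_eq_1:
  assumes "single_valued (parcs G)" "v \<in> Domain (parcs G)"
  shows "out_degree (with_proj G) v = 1"
proof -
  obtain y where "(v, y) \<in> parcs G" using assms by blast
  then have "{e \<in> parcs G. fst e = v} = {(v, y)}"
    using assms(1) by (auto simp: single_valued_def)
  then show ?thesis by (simp add: out_degree_parcs)
qed

lemma out_degree_eq_1D:
  assumes "out_degree (with_proj G) v = 1" "(v, y) \<in> parcs G" "(v, z) \<in> parcs G"
  shows "y = z"
proof -
  obtain e where e: "{e \<in> parcs G. fst e = v} = {e}"
    using assms(1) card_1_singletonE unfolding out_degree_parcs by blast
  have "(v, y) \<in> {e \<in> parcs G. fst e = v}" "(v, z) \<in> {e \<in> parcs G. fst e = v}"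
    using assms by auto
  then show ?thesis unfolding e by auto
qed

lemma pair_fin_digraph_iff:
  "pair_fin_digraph G \<longleftrightarrow> finite (pverts G) \<and> parcs G \<subseteq> pverts G \<times> pverts G"
proof
  assume "pair_fin_digraph G"
  then interpret pair_fin_digraph G .
  show "finite (pverts G) \<and> parcs G \<subseteq> pverts G \<times> pverts G"
    using pair_finite_verts in_arcsD1 in_arcsD2 by auto
next
  assume "finite (pverts G) \<and> parcs G \<subseteq> pverts G \<times> pverts G"
  then show "pair_fin_digraph G"
    by unfold_locales (auto intro: finite_subset)
qed

lemma connected_iff:
  assumes "parcs G \<subseteq> pverts G \<times> pverts G"
  shows "connected (with_proj G) \<longleftrightarrow>
    pverts G \<noteq> {} \<and> (\<forall>u\<in>pverts G. \<forall>v\<in>pverts G. (u, v) \<in> (parcs G \<union> (parcs G)\<inverse>)\<^sup>*)"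
proof -
  have "(u, v) \<in> rtrancl_on (pverts G) ((parcs G)\<^sup>s) \<longleftrightarrow> (u, v) \<in> (parcs G \<union> (parcs G)\<inverse>)\<^sup>*"
    if uv: "u \<in> pverts G" "v \<in> pverts G" for u v
  proof -
    have "(parcs G)\<^sup>s = parcs G \<union> (parcs G)\<inverse>" by (auto simp: symcl_def)
    moreover have "(u, v) \<in> rtrancl_on (pverts G) (parcs G \<union> (parcs G)\<inverse>)"
      if "(u, v) \<in> (parcs G \<union> (parcs G)\<inverse>)\<^sup>*"
      by (rule rtrancl_consistent_rtrancl_on[OF that uv]) (use assms in auto)
    ultimately show ?thesis by (auto dest: rtrancl_on_rtranclI)
  qed
  then show ?thesis by (simp add: connected_conv)
qed

lemma reachable_iff:
  assumes "parcs G \<subseteq> pverts G \<times> pverts G"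
  shows "u \<rightarrow>\<^sup>*\<^bsub>with_proj G\<^esub> v \<longleftrightarrow> (u, v) \<in> (parcs G)\<^sup>* \<and> u \<in> pverts G \<and> v \<in> pverts G"
proof -
  have "wf_digraph (with_proj G)" by unfold_locales (use assms in auto)
  then show ?thesis by (simp add: wf_digraph.reachable_conv)
qed

lemma comp_graph_single_valued: "comp_graph G \<Longrightarrow> single_valued (parcs G)"
  by (simp add: comp_graph_def loopfree_funs_def)

lemma comp_graph_pair_fin: "comp_graph G \<Longrightarrow> pair_fin_digraph G"
  by (simp add: comp_graph_def loopfree_funs_def pair_fin_digraph_iff)

lemma comp_graph_finite_parcs: "comp_graph G \<Longrightarrow> finite (parcs G)"
  by (auto simp: comp_graph_def loopfree_funs_def intro: finite_subset)

text \<open>Paths to the root give connectedness and exclude loops, since a loop would trap its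
  vertex. Conversely, in a connected functional graph a vertex without outgoing arc is reached from
  everywhere.\<close>

lemma rooted_tree_iff:
  "rooted_tree T \<longleftrightarrow> comp_graph T \<and> rootset (pverts T) (parcs T) \<noteq> {}"
proof
  assume T: "rooted_tree T"
  then have fin: "finite (pverts T)" and sub: "parcs T \<subseteq> pverts T \<times> pverts T"
    by (simp_all add: rooted_tree_def pair_fin_digraph_iff)
  obtain r where r: "r \<in> pverts T" "out_degree (with_proj T) r = 0"
    and reach: "\<And>v. v \<in> pverts T \<Longrightarrow> v \<rightarrow>\<^sup>*\<^bsub>with_proj T\<^esub> r"
    and deg: "\<And>v. v \<in> pverts T \<Longrightarrow> v \<noteq> r \<Longrightarrow> out_degree (with_proj T) v = 1"
    using T unfolding rooted_tree_def by - (elim conjE bexE, rule that; blast)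
  have "finite (parcs T)" using fin sub by (auto intro: finite_subset)
  then have rD: "r \<notin> Domain (parcs T)" using r(2) by (simp add: out_degree_eq_0)
  have reach': "(v, r) \<in> (parcs T)\<^sup>*" if "v \<in> pverts T" for v
    using reach[OF that] by (simp add: reachable_iff[OF sub])
  have sv: "single_valued (parcs T)"
  proof (rule single_valuedI)
    fix x y z assume xyz: "(x, y) \<in> parcs T" "(x, z) \<in> parcs T"
    then have "x \<in> pverts T" "x \<noteq> r" using rD sub by auto
    then show "y = z" using out_degree_eq_1D[OF deg xyz] by blast
  qed
  have "(x, x) \<notin> parcs T" for x
  proof
    assume xx: "(x, x) \<in> parcs T"
    then have "(x, r) \<in> (parcs T)\<^sup>*" using sub reach' by auto
    then have "r = x" by (induction rule: rtrancl_induct) (use xx sv in \<open>auto simp: single_valued_def\<close>)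
    then show False using xx rD by auto
  qed
  then have "parcs T \<in> loopfree_funs (pverts T)" using sub sv by (simp add: loopfree_funs_def)
  moreover have "(u, v) \<in> (parcs T \<union> (parcs T)\<inverse>)\<^sup>*" if "u \<in> pverts T" "v \<in> pverts T" for u v
  proof -
    have "(u, r) \<in> (parcs T \<union> (parcs T)\<inverse>)\<^sup>*"
      using reach'[OF that(1)] by (rule rev_subsetD) (intro rtrancl_mono; blast)
    moreover have "(r, v) \<in> ((parcs T)\<inverse>)\<^sup>*" using reach'[OF that(2)] by (rule rtrancl_converseI)
    then have "(r, v) \<in> (parcs T \<union> (parcs T)\<inverse>)\<^sup>*"
      by (rule rev_subsetD) (intro rtrancl_mono; blast)
    ultimately show ?thesis by (rule rtrancl_trans)
  qed
  ultimately have "comp_graph T" using fin r(1) unfolding comp_graph_def by blast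
  then show "comp_graph T \<and> rootset (pverts T) (parcs T) \<noteq> {}"
    using r(1) rD by (auto simp: rootset_def)
next
  assume asm: "comp_graph T \<and> rootset (pverts T) (parcs T) \<noteq> {}"
  then obtain r where r: "r \<in> pverts T" "r \<notin> Domain (parcs T)" and T: "comp_graph T"
    by (auto simp: rootset_def)
  have reach: "(v, r) \<in> (parcs T)\<^sup>*" if "v \<in> pverts T" for v
    using comp_graph_reaches[OF T r(1) _ that] r(2) by blast
  have "out_degree (with_proj T) v = 1" if "v \<in> pverts T" "v \<noteq> r" for v
  proof (rule out_degree_eq_1[OF comp_graph_single_valued[OF T]])
    show "v \<in> Domain (parcs T)"
      using reach[OF that(1)] by (rule converse_rtranclE) (use that(2) in auto)
  qed
  then show "rooted_tree T"
    unfolding rooted_tree_def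
    using T comp_graph_pair_fin[OF T] r reach out_degree_eq_0[OF comp_graph_finite_parcs[OF T], of r]
    by (intro conjI bexI[of _ r]) (auto simp: reachable_iff comp_graph_def loopfree_funs_def)
qed

lemma rootset_rooted_tree:
  assumes "rooted_tree T"
  shows "rootset (pverts T) (parcs T) = {root T}"
proof -
  from assms obtain r where r: "r \<in> pverts T" "r \<notin> Domain (parcs T)" and T: "comp_graph T"
    by (auto simp: rooted_tree_iff rootset_def)
  have uniq: "s = r" if "s \<in> pverts T" "s \<notin> Domain (parcs T)" for s
  proof -
    have "(s, r) \<in> (parcs T)\<^sup>*" using comp_graph_reaches[OF T r(1) _ that(1)] r(2) by blast
    then show ?thesis by (rule converse_rtranclE) (use that(2) in auto)
  qed
  have "root T = r"
    unfolding root_def out_degree_eq_0[OF comp_graph_finite_parcs[OF T]]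
    by (rule the_equality) (use r in blast, use uniq in blast)
  moreover have "rootset (pverts T) (parcs T) = {r}" unfolding rootset_def using r uniq by blast
  ultimately show ?thesis by simp
qed

text \<open>Outgoing arcs are unique, so a walk that starts on a cycle never leaves it.\<close>

lemma trancl_cycle_back:
  assumes "single_valued A" "(v, v) \<in> A\<^sup>+" "(v, a) \<in> A\<^sup>*"
  shows "(a, v) \<in> A\<^sup>*"
  using assms(3)
proof (induction rule: rtrancl_induct)
  case (step y z)
  have "(y, v) \<in> A\<^sup>+" using step assms(2) by (metis rtrancl_eq_or_trancl)
  then obtain z' where "(y, z') \<in> A" "(z', v) \<in> A\<^sup>*" by (auto dest: tranclD)
  then show ?case using step assms(1) by (auto simp: single_valued_def)
qed simp

text \<open>A loop at \<open>a\<close> would make all vertices of the connected graph flow into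
  \<open>a\<close>, leaving \<open>a\<close> as the only vertex on a cycle. Conversely, following
  arcs in a finite graph without roots must close up, and without loops the cycle contains a vertex
  and its distinct successor.\<close>

lemma cycle_of_trees_iff:
  "cycle_of_trees C \<and> cycle_length C \<ge> 2 \<longleftrightarrow> comp_graph C \<and> rootset (pverts C) (parcs C) = {}"
proof
  assume C: "cycle_of_trees C \<and> cycle_length C \<ge> 2"
  then have fin: "finite (pverts C)" and sub: "parcs C \<subseteq> pverts C \<times> pverts C"
    and deg: "\<And>v. v \<in> pverts C \<Longrightarrow> out_degree (with_proj C) v = 1"
    and conn: "connected (with_proj C)"
    unfolding cycle_of_trees_def pair_fin_digraph_iff by auto
  have fin_arcs: "finite (parcs C)" using fin sub by (auto intro: finite_subset)
  have sv: "single_valued (parcs C)"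
    by (rule single_valuedI) (use out_degree_eq_1D[OF deg] sub in blast)
  have conn': "(u, v) \<in> (parcs C \<union> (parcs C)\<inverse>)\<^sup>*" if "u \<in> pverts C" "v \<in> pverts C" for u v
    using conn that by (simp add: connected_iff[OF sub])
  have "(a, a) \<notin> parcs C" for a
  proof
    assume aa: "(a, a) \<in> parcs C"
    have "v = a" if v: "v \<in> pverts C" "(v, v) \<in> (parcs C)\<^sup>+" for v
    proof -
      have "(a, v) \<in> (parcs C \<union> (parcs C)\<inverse>)\<^sup>*" using conn' aa sub v by auto
      then have "(v, a) \<in> (parcs C)\<^sup>*"
      proof (induction rule: rtrancl_induct)
        case (step y z)
        then show ?case
          using rtrancl_single_valued_step[OF sv step.IH] aa sv
          by (cases "y = a") (auto dest: single_valuedD intro: converse_rtrancl_into_rtrancl)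
      qed simp
      then have "(a, v) \<in> (parcs C)\<^sup>*" using trancl_cycle_back[OF sv v(2)] by blast
      then show ?thesis
        by (induction rule: rtrancl_induct) (use aa sv in \<open>auto simp: single_valued_def\<close>)
    qed
    then have "{v \<in> pverts C. v \<rightarrow>\<^sup>+\<^bsub>with_proj C\<^esub> v} \<subseteq> {a}" by auto
    then have "cycle_length C \<le> card {a}" unfolding cycle_length_def by (intro card_mono) auto
    then show False using C by simp
  qed
  then have "parcs C \<in> loopfree_funs (pverts C)" using sub sv by (simp add: loopfree_funs_def)
  moreover have "v \<in> Domain (parcs C)" if "v \<in> pverts C" for v
    using deg[OF that] out_degree_eq_0[OF fin_arcs, of v] by auto
  ultimately show "comp_graph C \<and> rootset (pverts C) (parcs C) = {}"
    using fin conn by (auto simp: comp_graph_def rootset_def connected_iff[OF sub])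
next
  assume asm: "comp_graph C \<and> rootset (pverts C) (parcs C) = {}"
  then have C: "comp_graph C" and dom: "\<And>v. v \<in> pverts C \<Longrightarrow> v \<in> Domain (parcs C)"
    by (auto simp: rootset_def)
  have fin: "finite (pverts C)" and ne: "pverts C \<noteq> {}"
    and sub: "parcs C \<subseteq> pverts C \<times> pverts C"
    and irr: "\<And>x. (x, x) \<notin> parcs C"
    and conn: "\<forall>u\<in>pverts C. \<forall>v\<in>pverts C. (u, v) \<in> (parcs C \<union> (parcs C)\<inverse>)\<^sup>*"
    using C by (auto simp: comp_graph_def loopfree_funs_def)
  note sv = comp_graph_single_valued[OF C]
  have "\<not> acyclic (parcs C)"
  proof
    assume "acyclic (parcs C)"
    then have "wf ((parcs C)\<inverse>)"
      using comp_graph_finite_parcs[OF C] by (rule finite_acyclic_wf_converse[rotated])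
    then obtain z where "z \<in> pverts C" "\<And>y. (y, z) \<in> (parcs C)\<inverse> \<Longrightarrow> y \<notin> pverts C"
      using ne by (metis wfE_min ex_in_conv)
    then show False using dom[of z] sub by auto
  qed
  then obtain v where v: "(v, v) \<in> (parcs C)\<^sup>+" by (auto simp: acyclic_def)
  then obtain x where x: "(v, x) \<in> parcs C" "(x, v) \<in> (parcs C)\<^sup>*" by (auto dest: tranclD)
  have "(x, x) \<in> (parcs C)\<^sup>+" using x by (auto intro: rtrancl_into_trancl1)
  moreover have "x \<noteq> v" using x irr by auto
  moreover have "v \<in> pverts C" "x \<in> pverts C" using x sub by auto
  ultimately have "card {v, x} = 2" "{v, x} \<subseteq> {v \<in> pverts C. v \<rightarrow>\<^sup>+\<^bsub>with_proj C\<^esub> v}"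
    using v by auto
  then have "cycle_length C \<ge> 2"
    unfolding cycle_length_def using fin
    by (metis (no_types, lifting) card_mono finite_Collect_conjI finite_subset mem_Collect_eq subsetI)
  then show "cycle_of_trees C \<and> cycle_length C \<ge> 2"
    unfolding cycle_of_trees_def
    using comp_graph_pair_fin[OF C] ne conn out_degree_eq_1[OF sv dom]
    by (simp add: connected_iff[OF sub])
qed

text \<open>The new arc leaves the only root of \<open>T\<close>, so exactly the roots of
  \<open>G\<close> remain, and it connects the two pieces. Disjointness keeps the union
  single-valued.\<close>

lemma comp_graph_graft:
  assumes G: "comp_graph G" and T: "rooted_tree T" and disj: "pverts G \<inter> pverts T = {}"
    and v: "v \<in> pverts G"
  shows "comp_graph (graft G T v)"
    and "rootset (pverts (graft G T v)) (parcs (graft G T v)) = rootset (pverts G) (parcs G)"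
proof -
  have T': "comp_graph T" and r: "root T \<in> pverts T" "root T \<notin> Domain (parcs T)"
    and r_uniq: "\<And>s. s \<in> pverts T \<Longrightarrow> s \<notin> Domain (parcs T) \<Longrightarrow> s = root T"
    using T rootset_rooted_tree[OF T] by (auto simp: rooted_tree_iff rootset_def)
  have Gsub: "parcs G \<subseteq> pverts G \<times> pverts G" and Tsub: "parcs T \<subseteq> pverts T \<times> pverts T"
    and irr: "\<And>x. (x, x) \<notin> parcs G" "\<And>x. (x, x) \<notin> parcs T"
    using G T' by (auto simp: comp_graph_def loopfree_funs_def)
  let ?A = "parcs G \<union> parcs T \<union> {(root T, v)}"
  have "single_valued ?A"
    using comp_graph_single_valued[OF G] comp_graph_single_valued[OF T'] Gsub Tsub disj r v
    unfolding single_valued_def by blast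
  then have lf: "?A \<in> loopfree_funs (pverts G \<union> pverts T)"
    using Gsub Tsub irr r(1) v disj by (auto simp: loopfree_funs_def)
  let ?R = "(?A \<union> ?A\<inverse>)\<^sup>*"
  have sym: "(b, a) \<in> ?R" if "(a, b) \<in> ?R" for a b
    using sym_rtrancl[OF sym_Un_converse] that by (rule symD)
  have "(u, v) \<in> ?R" if "u \<in> pverts G \<union> pverts T" for u
  proof (cases "u \<in> pverts G")
    case True
    then have "(u, v) \<in> (parcs G \<union> (parcs G)\<inverse>)\<^sup>*" using G v by (simp add: comp_graph_def)
    then show ?thesis by (rule rev_subsetD) (intro rtrancl_mono; blast)
  next
    case False
    then have "(u, root T) \<in> (parcs T \<union> (parcs T)\<inverse>)\<^sup>*" using T' r that by (simp add: comp_graph_def)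
    then have "(u, root T) \<in> ?R" by (rule rev_subsetD) (intro rtrancl_mono; blast)
    then show ?thesis by (rule rtrancl_into_rtrancl) blast
  qed
  then have "(u, w) \<in> ?R" if "u \<in> pverts G \<union> pverts T" "w \<in> pverts G \<union> pverts T" for u w
    using that by (blast intro: rtrancl_trans[OF _ sym])
  then show "comp_graph (graft G T v)"
    using G T' lf by (simp add: comp_graph_def graft_def)
  show "rootset (pverts (graft G T v)) (parcs (graft G T v)) = rootset (pverts G) (parcs G)"
    unfolding graft_def rootset_def pair_pre_digraph.simps Domain_Un_eq Domain_insert Domain_empty
    using Gsub Tsub disj r r_uniq by blast
qed

text \<open>The new arc uses up the only root; \<open>v \<noteq> root T\<close> keeps the graph
  loop-free, matching the restriction to non-root vertices in \<open>div0\<close>.\<close>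

lemma comp_graph_close:
  assumes T: "rooted_tree T" and v: "v \<in> pverts T - {root T}"
  shows "comp_graph (T\<lparr>parcs := insert (root T, v) (parcs T)\<rparr>)"
    and "rootset (pverts T) (insert (root T, v) (parcs T)) = {}"
proof -
  have T': "comp_graph T" and r: "root T \<in> rootset (pverts T) (parcs T)"
    using T rootset_rooted_tree[OF T] by (auto simp: rooted_tree_iff)
  have "insert (root T, v) (parcs T) \<in> loopfree_funs (pverts T)"
    using T' r v by (intro loopfree_funs_insert) (auto simp: comp_graph_def)
  moreover have "(parcs T \<union> (parcs T)\<inverse>)\<^sup>*
      \<subseteq> (insert (root T, v) (parcs T) \<union> (insert (root T, v) (parcs T))\<inverse>)\<^sup>*"
    by (intro rtrancl_mono) blast
  ultimately show "comp_graph (T\<lparr>parcs := insert (root T, v) (parcs T)\<rparr>)"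
    using T' by (auto simp: comp_graph_def)
  show "rootset (pverts T) (insert (root T, v) (parcs T)) = {}"
    using rootset_rooted_tree[OF T] by (simp add: rootset_insert)
qed

section \<open>Words as partial functions\<close>

fun ltilde_graph :: "'v ltilde_gen \<Rightarrow> 'v pair_pre_digraph" where
  "ltilde_graph (Tree T) = T"
| "ltilde_graph (DCyc C) = C"

text \<open>A list with at most one entry: its length is the degree of the suspended generator, and
  concatenation along a word records the order of the odd factors.\<close>

fun ltilde_roots :: "'v ltilde_gen \<Rightarrow> 'v list" where
  "ltilde_roots (Tree T) = [root T]"
| "ltilde_roots (DCyc C) = []"

abbreviation ltilde_arcs :: "'v ltilde_gen \<Rightarrow> ('v \<times> 'v) set" where
  "ltilde_arcs x \<equiv> parcs (ltilde_graph x)"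

fun attach :: "'v ltilde_gen \<Rightarrow> 'v pair_pre_digraph \<Rightarrow> 'v \<Rightarrow> 'v ltilde_gen" where
  "attach (Tree S) T v = Tree (graft S T v)"
| "attach (DCyc C) T v = DCyc (graft C T v)"

definition close_up :: "'v pair_pre_digraph \<Rightarrow> 'v \<Rightarrow> 'v ltilde_gen" where
  "close_up T v = DCyc (T\<lparr>parcs := insert (root T, v) (parcs T)\<rparr>)"

text \<open>Trees and cycles under one condition: the second clause says that the constructor fits
  the graph, since \<open>ltilde_roots\<close> is nonempty for \<open>Tree\<close> and empty for
  \<open>DCyc\<close>.\<close>

definition ltilde_gens :: "'v ltilde_gen set" where
  "ltilde_gens = {x. comp_graph (ltilde_graph x) \<and>
     set (ltilde_roots x) = rootset (ltilde_labels x) (ltilde_arcs x)}"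

lemma pverts_ltilde_graph [simp]: "pverts (ltilde_graph x) = ltilde_labels x"
  by (cases x) auto

lemma Tree_in_ltilde_gens: "Tree T \<in> ltilde_gens \<longleftrightarrow> rooted_tree T"
  using rootset_rooted_tree[of T] by (auto simp: ltilde_gens_def rooted_tree_iff)

lemma DCyc_in_ltilde_gens: "DCyc C \<in> ltilde_gens \<longleftrightarrow> cycle_of_trees C \<and> cycle_length C \<ge> 2"
  by (auto simp: ltilde_gens_def cycle_of_trees_iff)

lemma gens_Ltilde: "gens (Ltilde :: ('v, 'v ltilde_gen, 'k::field_char_0) dg_lie) = ltilde_gens"
proof (rule set_eqI)
  fix x :: "'v ltilde_gen"
  show "x \<in> gens (Ltilde :: ('v, 'v ltilde_gen, 'k) dg_lie) \<longleftrightarrow> x \<in> ltilde_gens"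
    by (cases x) (auto simp: Ltilde_def Tree_in_ltilde_gens DCyc_in_ltilde_gens)
qed

lemma ltilde_gensD:
  assumes "x \<in> ltilde_gens"
  shows "finite (ltilde_labels x)" "ltilde_labels x \<noteq> {}"
    "ltilde_arcs x \<in> loopfree_funs (ltilde_labels x)"
    "ltilde_arcs x \<subseteq> ltilde_labels x \<times> ltilde_labels x"
    "set (ltilde_roots x) = rootset (ltilde_labels x) (ltilde_arcs x)"
    "set (ltilde_roots x) \<subseteq> ltilde_labels x"
  using assms by (auto simp: ltilde_gens_def comp_graph_def loopfree_funs_def rootset_def)

lemma attach_simps [simp]:
  "ltilde_labels (attach x T v) = ltilde_labels x \<union> pverts T"
  "ltilde_arcs (attach x T v) = insert (root T, v) (ltilde_arcs x \<union> parcs T)"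
  by (cases x; auto simp: graft_def)+

lemma close_up_simps [simp]:
  "ltilde_labels (close_up T v) = pverts T"
  "ltilde_arcs (close_up T v) = insert (root T, v) (parcs T)"
  "ltilde_roots (close_up T v) = []"
  by (auto simp: close_up_def)

lemma attach_in_ltilde_gens:
  assumes x: "x \<in> ltilde_gens" and T: "Tree T \<in> ltilde_gens"
    and disj: "ltilde_labels x \<inter> pverts T = {}" and v: "v \<in> ltilde_labels x"
  shows "attach x T v \<in> ltilde_gens" and "ltilde_roots (attach x T v) = ltilde_roots x"
proof -
  let ?G = "graft (ltilde_graph x) T v"
  have "rooted_tree T" using T by (simp add: Tree_in_ltilde_gens)
  then have G: "comp_graph ?G"
      "rootset (pverts ?G) (parcs ?G) = rootset (ltilde_labels x) (ltilde_arcs x)"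
    using comp_graph_graft[of "ltilde_graph x" T v] x disj v by (auto simp: ltilde_gens_def)
  have "attach x T v \<in> ltilde_gens \<and> ltilde_roots (attach x T v) = ltilde_roots x"
  proof (cases x)
    case (Tree S)
    have S: "rootset (pverts ?G) (parcs ?G) = {root S}"
      using ltilde_gensD(5)[OF x] G(2) Tree by simp
    then have "rooted_tree ?G" using G(1) by (simp add: rooted_tree_iff)
    moreover from rootset_rooted_tree[OF this] have "root ?G = root S" by (simp add: S)
    ultimately show ?thesis using Tree by (simp add: Tree_in_ltilde_gens)
  next
    case (DCyc C)
    then show ?thesis using G ltilde_gensD(5)[OF x] by (simp add: ltilde_gens_def)
  qed
  then show "attach x T v \<in> ltilde_gens" "ltilde_roots (attach x T v) = ltilde_roots x" by auto
qed

lemma close_up_in_ltilde_gens: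
  assumes "Tree T \<in> ltilde_gens" "v \<in> pverts T - {root T}"
  shows "close_up T v \<in> ltilde_gens"
  using comp_graph_close[of T v] assms
  by (simp add: Tree_in_ltilde_gens) (simp add: ltilde_gens_def close_up_def)

lemma singleton_in_ltilde_gens: "Tree \<lparr>pverts = {i}, parcs = {}\<rparr> \<in> ltilde_gens"
  by (simp add: Tree_in_ltilde_gens rooted_tree_iff comp_graph_def loopfree_funs_def rootset_def)

text \<open>The conditions of \<open>words\<close>, freed from nonemptiness and from a prescribed
  label set so that they pass to tails in inductions.\<close>

definition forest_list :: "'v ltilde_gen list \<Rightarrow> bool" where
  "forest_list w \<longleftrightarrow> set w \<subseteq> ltilde_gens \<and>
     sorted_wrt (\<lambda>x y. ltilde_labels x \<inter> ltilde_labels y = {}) w"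

definition word_labels :: "'v ltilde_gen list \<Rightarrow> 'v set" where
  "word_labels w = (\<Union>x\<in>set w. ltilde_labels x)"

definition word_arcs :: "'v ltilde_gen list \<Rightarrow> ('v \<times> 'v) set" where
  "word_arcs w = (\<Union>x\<in>set w. ltilde_arcs x)"

definition word_roots :: "'v ltilde_gen list \<Rightarrow> 'v list" where
  "word_roots w = concat (map ltilde_roots w)"

lemma word_simps [simp]:
  "word_labels [] = {}" "word_labels (x # w) = ltilde_labels x \<union> word_labels w"
  "word_labels (u @ w) = word_labels u \<union> word_labels w"
  "word_arcs [] = {}" "word_arcs (x # w) = ltilde_arcs x \<union> word_arcs w"
  "word_arcs (u @ w) = word_arcs u \<union> word_arcs w"
  "word_roots [] = []" "word_roots (x # w) = ltilde_roots x @ word_roots w"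
  "word_roots (u @ w) = word_roots u @ word_roots w"
  by (auto simp: word_labels_def word_arcs_def word_roots_def)

lemma forest_list_simps [simp]:
  "forest_list []"
  "forest_list (x # w) \<longleftrightarrow> x \<in> ltilde_gens \<and> ltilde_labels x \<inter> word_labels w = {} \<and> forest_list w"
  by (auto simp: forest_list_def word_labels_def)

lemma words_Ltilde:
  "words (Ltilde :: ('v, 'v ltilde_gen, 'k::field_char_0) dg_lie) I
    = {w. w \<noteq> [] \<and> forest_list w \<and> word_labels w = I}"
  by (auto simp: words_def forest_list_def word_labels_def gens_Ltilde) (auto simp: Ltilde_def)

lemma word_deg_Ltilde:
  "word_deg (Ltilde :: ('v, 'v ltilde_gen, 'k::field_char_0) dg_lie) w = int (length (word_roots w))"
proof (induction w)
  case (Cons x w)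
  then show ?case by (cases x) (auto simp: word_deg_def sdeg_def Ltilde_def)
qed (simp add: word_deg_def)

lemma word_mset_cong:
  assumes "mset w = mset w'"
  shows "word_labels w = word_labels w'" "word_arcs w = word_arcs w'"
    "length (word_roots w) = length (word_roots w')"
proof -
  have "set w = set w'" using assms by (rule mset_eq_setD)
  then show "word_labels w = word_labels w'" "word_arcs w = word_arcs w'"
    by (auto simp: word_labels_def word_arcs_def)
  have "length (word_roots u) = sum_mset (image_mset (\<lambda>x. length (ltilde_roots x)) (mset u))" for u :: "'a ltilde_gen list"
    by (induction u) auto
  then show "length (word_roots w) = length (word_roots w')" using assms by simp
qed

lemma forest_list_append:
  "forest_list (u @ w) \<longleftrightarrow> forest_list u \<and> forest_list w \<and> word_labels u \<inter> word_labels w = {}"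
  by (induction u) auto

lemma forest_list_mset:
  assumes "mset w = mset w'" "forest_list w"
  shows "forest_list w'"
  using assms
proof (induction w arbitrary: w')
  case (Cons x w)
  then have "x \<in> set w'" by (metis list.set_intros(1) mset_eq_setD)
  then obtain a b where w': "w' = a @ x # b" by (meson split_list)
  then have ab: "mset w = mset (a @ b)" using Cons.prems by simp
  then have "forest_list (a @ b)" using Cons by simp
  moreover have "ltilde_labels x \<inter> word_labels (a @ b) = {}"
    using Cons.prems word_mset_cong(1)[OF ab] by simp
  ultimately show ?case using Cons.prems by (auto simp: w' forest_list_append)
qed simp

lemma forest_list_disjoint:
  assumes "forest_list w" "x \<in> set w" "y \<in> set w" "x \<noteq> y"
  shows "ltilde_labels x \<inter> ltilde_labels y = {}"
  using assms by (induction w) (auto simp: word_labels_def)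

lemma forest_list_gens: "forest_list w \<Longrightarrow> x \<in> set w \<Longrightarrow> x \<in> ltilde_gens"
  by (auto simp: forest_list_def)

text \<open>Label sets are nonempty and pairwise disjoint, so no factor repeats. In particular no
  odd factor is multiplied with itself, and no word is identified with its own negative.\<close>

lemma forest_list_distinct: "forest_list w \<Longrightarrow> distinct w"
proof (induction w)
  case (Cons x w)
  then show ?case using ltilde_gensD(2)[of x] by (auto simp: word_labels_def)
qed simp

lemma word_arcs_subset:
  assumes "forest_list w"
  shows "word_arcs w \<subseteq> word_labels w \<times> word_labels w"
proof -
  have "ltilde_arcs x \<subseteq> word_labels w \<times> word_labels w" if "x \<in> set w" for x
    using ltilde_gensD(4)[OF forest_list_gens[OF assms that]] that by (auto simp: word_labels_def)
  then show ?thesis unfolding word_arcs_def by blast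
qed

lemma forest_list_loopfree: "forest_list w \<Longrightarrow> word_arcs w \<in> loopfree_funs (word_labels w)"
proof (induction w)
  case (Cons x w)
  then have "single_valued (ltilde_arcs x \<union> word_arcs w)"
    using ltilde_gensD(3,4)[of x] word_arcs_subset[of w]
    by (simp add: loopfree_funs_def) (simp add: single_valued_def, blast)
  then show ?case using Cons ltilde_gensD(3,4)[of x] by (auto simp: loopfree_funs_def)
qed (simp add: loopfree_funs_def)

lemma set_word_roots: "forest_list w \<Longrightarrow> set (word_roots w) = rootset (word_labels w) (word_arcs w)"
proof (induction w)
  case (Cons x w)
  then have "rootset (word_labels (x # w)) (word_arcs (x # w))
      = rootset (ltilde_labels x) (ltilde_arcs x) \<union> rootset (word_labels w) (word_arcs w)"
    using ltilde_gensD(4)[of x] word_arcs_subset[of w] by (auto simp: rootset_def)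
  then show ?case using Cons ltilde_gensD(5)[of x] by simp
qed (simp add: rootset_def)

lemma distinct_word_roots: "forest_list w \<Longrightarrow> distinct (word_roots w)"
proof (induction w)
  case (Cons x w)
  have "set (word_roots w) \<subseteq> word_labels w" using Cons by (auto simp: set_word_roots rootset_def)
  moreover have "distinct (ltilde_roots x)" by (cases x) auto
  ultimately show ?case using Cons ltilde_gensD(6)[of x] by auto
qed simp

lemma attach_forest_list:
  assumes "forest_list (x # Tree T # w)" "v \<in> ltilde_labels x"
  shows "forest_list (attach x T v # w)"
    and "word_labels (attach x T v # w) = word_labels (x # Tree T # w)"
    and "word_arcs (attach x T v # w) = insert (root T, v) (word_arcs (x # Tree T # w))"
    and "word_roots (attach x T v # w) = word_roots (x # w)"
  using assms attach_in_ltilde_gens[of x T v] by auto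

lemma close_up_forest_list:
  assumes "forest_list (Tree T # w)" "v \<in> pverts T - {root T}"
  shows "forest_list (close_up T v # w)"
    and "word_labels (close_up T v # w) = word_labels (Tree T # w)"
    and "word_arcs (close_up T v # w) = insert (root T, v) (word_arcs (Tree T # w))"
    and "word_roots (close_up T v # w) = word_roots w"
  using assms close_up_in_ltilde_gens[of T v] by auto

section \<open>The factors of a word as connected components of its graph\<close>

lemma ltilde_labels_component:
  assumes w: "forest_list w" and x: "x \<in> set w" and a: "a \<in> ltilde_labels x"
  shows "ltilde_labels x = {u. (a, u) \<in> (word_arcs w \<union> (word_arcs w)\<inverse>)\<^sup>*}"
proof
  have "comp_graph (ltilde_graph x)" using forest_list_gens[OF w x] by (simp add: ltilde_gens_def)
  then have "(a, u) \<in> (ltilde_arcs x \<union> (ltilde_arcs x)\<inverse>)\<^sup>*" if "u \<in> ltilde_labels x" for u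
    using a that by (simp add: comp_graph_def)
  moreover have "(ltilde_arcs x \<union> (ltilde_arcs x)\<inverse>)\<^sup>* \<subseteq> (word_arcs w \<union> (word_arcs w)\<inverse>)\<^sup>*"
    using x by (intro rtrancl_mono) (auto simp: word_arcs_def)
  ultimately show "ltilde_labels x \<subseteq> {u. (a, u) \<in> (word_arcs w \<union> (word_arcs w)\<inverse>)\<^sup>*}" by blast
  have closed: "y \<in> ltilde_labels x \<longleftrightarrow> z \<in> ltilde_labels x" if yz: "(y, z) \<in> word_arcs w" for y z
  proof -
    obtain x' where x': "x' \<in> set w" "(y, z) \<in> ltilde_arcs x'" using yz by (auto simp: word_arcs_def)
    then have "y \<in> ltilde_labels x'" "z \<in> ltilde_labels x'"
      using ltilde_gensD(4)[OF forest_list_gens[OF w x'(1)]] by auto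
    then show ?thesis using forest_list_disjoint[OF w x x'(1)] by (cases "x = x'") auto
  qed
  show "{u. (a, u) \<in> (word_arcs w \<union> (word_arcs w)\<inverse>)\<^sup>*} \<subseteq> ltilde_labels x"
  proof
    fix u assume "u \<in> {u. (a, u) \<in> (word_arcs w \<union> (word_arcs w)\<inverse>)\<^sup>*}"
    then have "(a, u) \<in> (word_arcs w \<union> (word_arcs w)\<inverse>)\<^sup>*" by simp
    then show "u \<in> ltilde_labels x"
      by (induction rule: rtrancl_induct) (use a closed in auto)
  qed
qed

lemma ltilde_arcs_component:
  assumes w: "forest_list w" and x: "x \<in> set w"
  shows "ltilde_arcs x = word_arcs w \<inter> ltilde_labels x \<times> ltilde_labels x"
proof
  show "ltilde_arcs x \<subseteq> word_arcs w \<inter> ltilde_labels x \<times> ltilde_labels x"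
    using ltilde_gensD(4)[OF forest_list_gens[OF w x]] x by (auto simp: word_arcs_def)
  show "word_arcs w \<inter> ltilde_labels x \<times> ltilde_labels x \<subseteq> ltilde_arcs x"
  proof (rule subrelI)
    fix y z assume yz: "(y, z) \<in> word_arcs w \<inter> ltilde_labels x \<times> ltilde_labels x"
    then obtain x' where x': "x' \<in> set w" "(y, z) \<in> ltilde_arcs x'" by (auto simp: word_arcs_def)
    then have "y \<in> ltilde_labels x'" using ltilde_gensD(4)[OF forest_list_gens[OF w x'(1)]] by auto
    then show "(y, z) \<in> ltilde_arcs x"
      using yz x' forest_list_disjoint[OF w x x'(1)] by (cases "x = x'") auto
  qed
qed

text \<open>The graph decides the constructor: having a root tells a tree from a cycle.\<close>

lemma ltilde_gens_eqI:
  assumes "x \<in> ltilde_gens" "y \<in> ltilde_gens"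
    "ltilde_labels x = ltilde_labels y" "ltilde_arcs x = ltilde_arcs y"
  shows "x = y"
proof -
  have g: "ltilde_graph x = ltilde_graph y" using assms(3,4) by (auto intro: pair_pre_digraph.equality)
  have "set (ltilde_roots x) = set (ltilde_roots y)"
    using assms by (simp add: ltilde_gensD(5))
  then show ?thesis using g by (cases x; cases y) auto
qed

text \<open>A factor is the connected component of any of its labels together with the arrows inside
  it; both depend only on the labels and arcs of the whole word.\<close>

lemma forest_list_subset:
  assumes w: "forest_list w" and w': "forest_list w'"
    and eq: "word_labels w = word_labels w'" "word_arcs w = word_arcs w'"
  shows "set w \<subseteq> set w'"
proof
  fix x assume x: "x \<in> set w"
  then obtain a where a: "a \<in> ltilde_labels x" using ltilde_gensD(2) forest_list_gens[OF w] by blast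
  then have "a \<in> word_labels w'" using x eq(1) by (auto simp: word_labels_def)
  then obtain y where y: "y \<in> set w'" "a \<in> ltilde_labels y" by (auto simp: word_labels_def)
  have labels: "ltilde_labels x = ltilde_labels y"
    using ltilde_labels_component[OF w x a] ltilde_labels_component[OF w' y] eq(2) by simp
  then have "ltilde_arcs x = ltilde_arcs y"
    using ltilde_arcs_component[OF w x] ltilde_arcs_component[OF w' y(1)] eq(2) by simp
  then have "x = y"
    using labels by (intro ltilde_gens_eqI forest_list_gens[OF w x] forest_list_gens[OF w' y(1)])
  then show "x \<in> set w'" using y by simp
qed

lemma forest_list_unique:
  assumes "forest_list w" "forest_list w'" "word_labels w = word_labels w'" "word_arcs w = word_arcs w'"
  shows "mset w = mset w'"
  using forest_list_subset[OF assms] forest_list_subset[OF assms(2,1)] assms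
  by (simp add: forest_list_distinct flip: set_eq_iff_mset_eq_distinct)

text \<open>
  The decomposition into components is built up edge by edge: a new edge out of a root either closes
  up its tree or grafts it onto another component.
\<close>

lemma forest_list_exists:
  assumes "finite I" "A \<in> loopfree_funs I"
  shows "\<exists>w. forest_list w \<and> word_labels w = I \<and> word_arcs w = A"
proof -
  have "finite A"
    using assms by (auto simp: loopfree_funs_def intro: finite_subset)
  then show ?thesis using assms(2)
  proof (induction A rule: finite_induct)
    case empty
    obtain xs where xs: "set xs = I" "distinct xs" using finite_distinct_list[OF assms(1)] by blast
    let ?w = "map (\<lambda>i. Tree \<lparr>pverts = {i}, parcs = {}\<rparr>) xs"
    have "forest_list ?w \<and> word_labels ?w = set xs \<and> word_arcs ?w = {}"
      using xs(2) by (induction xs) (auto simp: singleton_in_ltilde_gens)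
    then show ?case using xs by blast
  next
    case (insert e A)
    obtain r v where e: "e = (r, v)" by fastforce
    have A: "A \<in> loopfree_funs I" using insert.prems by (rule loopfree_funs_mono) blast
    then obtain w where w: "forest_list w" "word_labels w = I" "word_arcs w = A"
      using insert.IH by blast
    have rv: "r \<in> I" "v \<in> I" "r \<noteq> v" using insert.prems by (auto simp: e loopfree_funs_def)
    have "r \<in> rootset I A"
      using rv insert.prems insert.hyps by (auto simp: e rootset_def loopfree_funs_def single_valued_def)
    then have "r \<in> set (word_roots w)" using w by (simp add: set_word_roots)
    then obtain x where x: "x \<in> set w" "r \<in> set (ltilde_roots x)" by (auto simp: word_roots_def)
    obtain T where T: "x = Tree T" "r = root T" using x(2) by (cases x) auto
    obtain y where y: "y \<in> set w" "v \<in> ltilde_labels y" using rv w(2) by (auto simp: word_labels_def)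
    show ?case
    proof (cases "y = x")
      case True
      have m: "mset w = mset (Tree T # remove1 x w)" using x T by simp
      have f: "forest_list (Tree T # remove1 x w)" using forest_list_mset[OF m w(1)] .
      have v: "v \<in> pverts T - {root T}" using y True T rv by auto
      show ?thesis
        using close_up_forest_list[OF f v] word_mset_cong[OF m] w e T(2) by metis
    next
      case False
      obtain a b where ab: "w = a @ x # b" using x(1) by (meson split_list)
      then have "y \<in> set (a @ b)" using y(1) False by auto
      then obtain c d where "a @ b = c @ y # d" by (meson split_list)
      then have "mset a + mset b = mset (c @ y # d)" by (simp flip: mset_append)
      then have m: "mset w = mset (y # Tree T # c @ d)" by (simp add: ab T)
      have f: "forest_list (y # Tree T # c @ d)" using forest_list_mset[OF m w(1)] .
      show ?thesis
        using attach_forest_list[OF f y(2)] word_mset_cong[OF m] w e T(2) by metis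
    qed
  qed
qed

section \<open>Comparison with the Chevalley--Eilenberg complex\<close>

text \<open>For distinct entries with distinct indices this is the parity of inversions, the sign of
  the permutation sorting the list by \<open>idx\<close>. It compares the orientation given by a
  word with the reference order used in \<open>bd\<close>.\<close>

fun list_sign :: "('v \<Rightarrow> nat) \<Rightarrow> 'v list \<Rightarrow> 'k::field_char_0" where
  "list_sign idx [] = 1"
| "list_sign idx (x # xs) = eps idx x (set xs) * list_sign idx xs"

lemma list_sign_mult_self [simp]: "list_sign idx xs * list_sign idx xs = (1 :: 'k::field_char_0)"
proof (induction xs)
  case (Cons x xs)
  have "list_sign idx (x # xs) * list_sign idx (x # xs)
      = (eps idx x (set xs) * eps idx x (set xs)) * (list_sign idx xs * list_sign idx xs :: 'k)"
    by simp
  then show ?case by (simp only: Cons eps_mult_self mult_1)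
qed simp

lemma eps_insert_self [simp]: "eps idx x (insert x S) = eps idx x S"
proof -
  have "{s \<in> insert x S. idx s < idx x} = {s \<in> S. idx s < idx x}" by auto
  then show ?thesis by (simp only: eps_def)
qed

lemma list_sign_swap:
  assumes "distinct (u @ x # y # v)" "inj_on idx (set (u @ x # y # v))"
  shows "(list_sign idx (u @ x # y # v) :: 'k::field_char_0) = - list_sign idx (u @ y # x # v)"
  using assms
proof (induction u)
  case Nil
  let ?S = "insert x (insert y (set v))"
  have "?S - {x} = insert y (set v)" "?S - {y} = insert x (set v)" using Nil by auto
  moreover have "(eps idx x ?S :: 'k) = eps idx x (insert y (set v))"
      "(eps idx y ?S :: 'k) = eps idx y (insert x (set v))"
    by (simp, subst insert_commute, simp)
  ultimately have "(eps idx x (insert y (set v)) * eps idx y (set v) :: 'k)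
      = - (eps idx y (insert x (set v)) * eps idx x (set v))"
    using eps_anticommute[of ?S idx x y, where 'k = 'k] Nil by simp
  then show ?case by (simp flip: mult.assoc)
next
  case (Cons a u)
  then show ?case by (simp add: insert_commute)
qed

lemma list_sign_move:
  assumes "distinct (u @ x # v)" "inj_on idx (set (u @ x # v))"
  shows "(list_sign idx (u @ x # v) :: 'k::field_char_0) = (-1) ^ length u * list_sign idx (x # u @ v)"
  using assms
proof (induction u)
  case (Cons a u)
  have "list_sign idx ((a # u) @ x # v) = (-1) ^ length u * (list_sign idx (a # x # u @ v) :: 'k)"
    using Cons by simp
  also have "list_sign idx (a # x # u @ v) = - (list_sign idx (x # a # u @ v) :: 'k)"
    using list_sign_swap[of "[]" a x "u @ v" idx, where 'k = 'k] Cons.prems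
    by (simp add: insert_commute)
  finally show ?case by simp
qed simp

lemma list_sign_move_block:
  assumes "distinct (u @ b @ v)" "inj_on idx (set (u @ b @ v))" "length b \<le> 1"
  shows "(list_sign idx (u @ b @ v) :: 'k::field_char_0)
    = (-1) ^ (length b * length u) * list_sign idx (b @ u @ v)"
proof (cases b)
  case (Cons x b')
  then show ?thesis using assms list_sign_move[of u x v idx, where 'k = 'k] by simp
qed simp

text \<open>Moving \<open>x\<close> to the front costs one sign per entry of \<open>u\<close>; its
  inversions with the rest then cancel against the sign with which \<open>bd\<close> uses the root
  \<open>x\<close>. Position in the word thus replaces position in the reference order.\<close>

lemma list_sign_remove:
  assumes "distinct (u @ x # v)" "inj_on idx (set (u @ x # v))"
  shows "(list_sign idx (u @ x # v) * eps idx x (set (u @ x # v)) :: 'k::field_char_0)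
    = (-1) ^ length u * list_sign idx (u @ v)"
proof -
  have "(eps idx x (set (u @ x # v)) :: 'k) = eps idx x (set (u @ v))" by simp
  moreover have "(eps idx x (set (u @ v)) * list_sign idx (u @ v)) * eps idx x (set (u @ v))
      = (eps idx x (set (u @ v)) * eps idx x (set (u @ v))) * (list_sign idx (u @ v) :: 'k)"
    by (simp only: mult_ac)
  ultimately show ?thesis
    unfolding list_sign_move[OF assms] list_sign.simps
    by (simp only: eps_mult_self mult_1 mult.assoc)
qed

text \<open>\<open>X\<close> and \<open>[r]\<close> are the root lists of two bracketed factors, the
  second attached to the first: \<open>r\<close> disappears and \<open>X\<close> comes to the front.
  \<open>U\<close>, \<open>M\<close> and \<open>Z\<close> are the roots before, between and after
  them.\<close>

lemma list_sign_remove_second: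
  assumes "distinct (U @ X @ M @ [r] @ Z)" "inj_on idx (set (U @ X @ M @ [r] @ Z))" "length X \<le> 1"
  shows "(list_sign idx (U @ X @ M @ [r] @ Z) * eps idx r (set (U @ X @ M @ [r] @ Z)) :: 'k::field_char_0)
    = (-1) ^ (length X + length X * length U + length U + length M) * list_sign idx (X @ U @ M @ Z)"
proof -
  have "(list_sign idx ((U @ X @ M) @ r # Z) * eps idx r (set ((U @ X @ M) @ r # Z)) :: 'k)
      = (-1) ^ length (U @ X @ M) * list_sign idx ((U @ X @ M) @ Z)"
    by (rule list_sign_remove) (use assms in simp_all)
  moreover have "(list_sign idx (U @ X @ (M @ Z)) :: 'k)
      = (-1) ^ (length X * length U) * list_sign idx (X @ U @ (M @ Z))"
    by (rule list_sign_move_block) (use assms in \<open>auto intro: inj_on_subset\<close>)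
  ultimately show ?thesis by (simp add: power_add mult_ac)
qed

lemma list_sign_remove_first:
  assumes "distinct (U @ [r] @ M @ Y @ Z)" "inj_on idx (set (U @ [r] @ M @ Y @ Z))" "length Y \<le> 1"
  shows "(list_sign idx (U @ [r] @ M @ Y @ Z) * eps idx r (set (U @ [r] @ M @ Y @ Z)) :: 'k::field_char_0)
    = (-1) ^ (length U + length Y * (length U + length M)) * list_sign idx (Y @ U @ M @ Z)"
proof -
  have "(list_sign idx (U @ r # (M @ Y @ Z)) * eps idx r (set (U @ r # (M @ Y @ Z))) :: 'k)
      = (-1) ^ length U * list_sign idx (U @ (M @ Y @ Z))"
    by (rule list_sign_remove) (use assms in simp_all)
  moreover have "(list_sign idx ((U @ M) @ Y @ Z) :: 'k)
      = (-1) ^ (length Y * length (U @ M)) * list_sign idx (Y @ (U @ M) @ Z)"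
    by (rule list_sign_move_block) (use assms in \<open>auto intro: inj_on_subset\<close>)
  ultimately show ?thesis by (simp add: power_add mult_ac)
qed

section \<open>Chains, relations and structure maps in terms of words\<close>

definition forests :: "'v set \<Rightarrow> int \<Rightarrow> 'v ltilde_gen list set" where
  "forests I k = {w. w \<noteq> [] \<and> forest_list w \<and> word_labels w = I \<and> int (length (word_roots w)) = k}"

lemma tensors_Ltilde:
  "tensors Ltilde I k = {p :: 'v ltilde_gen list \<Rightarrow>\<^sub>0 'k::field_char_0. Poly_Mapping.keys p \<subseteq> forests I k}"
proof -
  have "{w \<in> words (Ltilde :: ('v, 'v ltilde_gen, 'k) dg_lie) I.
      word_deg (Ltilde :: ('v, 'v ltilde_gen, 'k) dg_lie) w = k} = forests I k"
    by (auto simp: words_Ltilde word_deg_Ltilde forests_def)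
  then show ?thesis by (simp add: tensors_def span_vec)
qed

lemma sdeg_Ltilde: "sdeg (Ltilde :: ('v, 'v ltilde_gen, 'k::field_char_0) dg_lie) x = int (length (ltilde_roots x))"
  by (cases x) (auto simp: sdeg_def Ltilde_def)

lemma sym_relations_Ltilde:
  "sym_relations Ltilde I k = free_vs.span
     {vec (u @ [x, y] @ v) - smul ((-1) ^ (length (ltilde_roots x) * length (ltilde_roots y))) (vec (u @ [y, x] @ v))
       :: 'v ltilde_gen list \<Rightarrow>\<^sub>0 'k::field_char_0 | u x y v. u @ [x, y] @ v \<in> forests I k}"
proof -
  have "(-1 :: 'k) powi (int m * int n) = (-1) ^ (m * n)" for m n
    by (metis of_nat_mult power_int_of_nat)
  then show ?thesis
    by (simp add: sym_relations_def words_Ltilde word_deg_Ltilde forests_def sdeg_Ltilde conj_ac)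
qed

lemma subspace_tensors: "free_vs.subspace (tensors Ltilde I k :: ('v ltilde_gen list \<Rightarrow>\<^sub>0 'k::field_char_0) set)"
  by (simp add: tensors_Ltilde subspace_keys)

lemma subspace_sym_relations: "free_vs.subspace (sym_relations L I k)"
  by (simp add: sym_relations_def)

lemma forests_mset: "w \<in> forests I k \<Longrightarrow> mset w = mset w' \<Longrightarrow> w' \<in> forests I k"
  using word_mset_cong[of w w'] forest_list_mset[of w w'] by (auto simp: forests_def)

text \<open>One half of the bracket, in which the root of \<open>y\<close> is attached to
  \<open>x\<close>. A cycle has no root to attach, hence the value 0.\<close>

definition graft_terms :: "'v ltilde_gen \<Rightarrow> 'v ltilde_gen \<Rightarrow> ('v ltilde_gen \<Rightarrow>\<^sub>0 'k::field_char_0)" where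
  "graft_terms x y = (case y of Tree T \<Rightarrow> (\<Sum>v\<in>ltilde_labels x. vec (attach x T v)) | DCyc _ \<Rightarrow> 0)"

text \<open>One antisymmetrised formula covers all four cases of the bracket, including the opposite
  signs for tree with cycle and cycle with tree.\<close>

lemma ltilde_lie_eq: "ltilde_lie x y = (graft_terms x y - graft_terms y x :: _ \<Rightarrow>\<^sub>0 'k::field_char_0)"
  by (cases x; cases y)
    (simp_all add: graft_terms_def graft_sum_def lin_ext_diff lin_ext_sum)

lemma ltilde_dif_Tree:
  "ltilde_dif (Tree T) = (\<Sum>v\<in>pverts T - {root T}. vec (close_up T v) :: _ \<Rightarrow>\<^sub>0 'k::field_char_0)"
  by (simp add: div0_def lin_ext_sum close_up_def)

lemma sum_sdeg_Ltilde:
  assumes "i \<le> length w"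
  shows "(\<Sum>a<i. sdeg (Ltilde :: ('v, 'v ltilde_gen, 'k::field_char_0) dg_lie) (w ! a))
    = int (length (word_roots (take i w)))"
proof -
  let ?f = "sdeg (Ltilde :: ('v, 'v ltilde_gen, 'k) dg_lie)"
  have "(\<Sum>a<i. ?f (w ! a)) = sum_list (map ?f (take i w))"
    using assms by (simp add: sum_list_sum_nth atLeast0LessThan)
  then show ?thesis
    using word_deg_Ltilde[of "take i w", where 'k = 'k] by (simp add: word_deg_def)
qed

lemma nths_remove_two:
  "nths (u @ x # m @ y # z) (- {length u, Suc (length u + length m)}) = u @ m @ z"
proof -
  have 1: "nths u (- {length u, Suc (length u + length m)}) = u" by (rule nths_all) auto
  have 2: "{j. Suc j + length u \<in> - {length u, Suc (length u + length m)}} = - {length m}" by auto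
  have 3: "nths m (- {length m}) = m" by (rule nths_all) auto
  have 4: "nths z {j. Suc j + length m \<in> - {length m}} = z" by (rule nths_all) auto
  show ?thesis using 1 2 3 4 by (simp add: nths_append nths_Cons)
qed

text \<open>For pairs of factors of a word, the diagonal matches \<open>d1_CE\<close> and the pairs
  \<open>i < j\<close> match the summands of \<open>d2_CE\<close>, each of which attaches in both
  directions.\<close>

lemma sum_square_split:
  "(\<Sum>i<n. \<Sum>j<n. f i j) = (\<Sum>i<n. f i i) + (\<Sum>j<n. \<Sum>i<j. f i j + f j i :: 'a::ab_group_add)"
  for n :: nat
  by (induction n) (auto simp: sum.distrib algebra_simps)

lemma length_ltilde_roots: "length (ltilde_roots x) \<le> 1"
  by (cases x) auto

context enumerated_labels
begin

text \<open>
  The comparison map anticommutes with the differentials, since both parts of the Chevalley--Eilenberg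
  differential carry the sign of \<open>s x \<mapsto> - s (d x)\<close>.
\<close>

definition word_vec :: "'v ltilde_gen list \<Rightarrow> (('v \<times> 'v) set \<Rightarrow>\<^sub>0 'k::field_char_0)" where
  "word_vec w = smul (list_sign idx (word_roots w)) (vec (word_arcs w))"

text \<open>
  \<open>pair_term A x y\<close> is the part of \<open>bd A\<close> that joins the root of \<open>x\<close>, if any, to the vertices of \<open>y\<close>: the
  diagonal terms come from \<^const>\<open>d1_CE\<close>, the others from \<^const>\<open>d2_CE\<close>.
\<close>

definition arrow_term :: "('v \<times> 'v) set \<Rightarrow> 'v set \<Rightarrow> 'v \<Rightarrow> (('v \<times> 'v) set \<Rightarrow>\<^sub>0 'k::field_char_0)" where
  "arrow_term A V r = smul (eps idx r (rootset I A)) (\<Sum>v\<in>V - {r}. vec (insert (r, v) A))"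

definition pair_term :: "('v \<times> 'v) set \<Rightarrow> 'v ltilde_gen \<Rightarrow> 'v ltilde_gen \<Rightarrow> (('v \<times> 'v) set \<Rightarrow>\<^sub>0 'k::field_char_0)" where
  "pair_term A x y = (\<Sum>r\<in>set (ltilde_roots x). arrow_term A (ltilde_labels y) r)"

lemma arrow_term_word_labels:
  "forest_list w \<Longrightarrow> finite (word_labels w) \<Longrightarrow>
    arrow_term A (word_labels w) r
      = (\<Sum>y\<leftarrow>w. arrow_term A (ltilde_labels y) r :: _ \<Rightarrow>\<^sub>0 'k::field_char_0)"
proof (induction w)
  case (Cons y w)
  have "(ltilde_labels y \<union> word_labels w) - {r} = (ltilde_labels y - {r}) \<union> (word_labels w - {r})" by auto
  then have "arrow_term A (ltilde_labels y \<union> word_labels w) r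
      = (arrow_term A (ltilde_labels y) r + arrow_term A (word_labels w) r :: _ \<Rightarrow>\<^sub>0 'k)"
    using Cons.prems unfolding arrow_term_def
    by (subst free_vs.scale_right_distrib[symmetric], simp, subst sum.union_disjoint) auto
  then show ?case using Cons by simp
qed (simp add: arrow_term_def)

lemma bd_word_arcs:
  assumes w: "forest_list w" "word_labels w = I"
  shows "bd (word_arcs w) = (\<Sum>i<length w. \<Sum>j<length w.
    pair_term (word_arcs w) (w ! i) (w ! j) :: _ \<Rightarrow>\<^sub>0 'k::field_char_0)"
proof -
  let ?A = "word_arcs w"
  have fin: "finite (word_labels w)" by (simp add: w(2) finite_I)
  have roots: "(\<Sum>r\<in>set (word_roots u). g r) = (\<Sum>x\<leftarrow>u. \<Sum>r\<in>set (ltilde_roots x). g r)"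
    if "distinct (word_roots u)" for u and g :: "'v \<Rightarrow> ('v \<times> 'v) set \<Rightarrow>\<^sub>0 'k"
    using that by (induction u) (auto simp: sum.union_disjoint)
  have "bd ?A = (\<Sum>r\<in>set (word_roots w). arrow_term ?A (word_labels w) r :: _ \<Rightarrow>\<^sub>0 'k)"
    by (simp add: bd_def arrow_term_def set_word_roots w)
  also have "\<dots> = (\<Sum>x\<leftarrow>w. \<Sum>r\<in>set (ltilde_roots x). \<Sum>y\<leftarrow>w. arrow_term ?A (ltilde_labels y) r)"
    by (simp only: roots[OF distinct_word_roots[OF w(1)]] arrow_term_word_labels[OF w(1) fin])
  also have "\<dots> = (\<Sum>x\<leftarrow>w. \<Sum>y\<leftarrow>w. pair_term ?A x y)"
    unfolding pair_term_def by (simp add: sum_list_sum_nth sum.swap[of _ _ "set _"])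
  finally show ?thesis by (simp add: sum_list_sum_nth atLeast0LessThan)
qed

lemma inj_idx_word_roots:
  assumes "forest_list w" "word_labels w = I"
  shows "inj_on idx (set (word_roots w))"
  using inj_idx_rootset[of "word_arcs w"] assms by (simp add: set_word_roots)

text \<open>By \<open>list_sign_remove\<close>, losing the root of factor \<open>i\<close> turns the
  sign in \<open>bd\<close> into one sign per root in front of it, which is the Koszul sign in
  \<open>d1_CE\<close>. The remaining minus comes from
  \<open>s x \<mapsto> - s (d x)\<close>.\<close>

lemma d1_term:
  assumes w: "w \<in> forests I k" and i: "i < length w"
  defines "t \<equiv> smul ((-1) powi (\<Sum>a<i. sdeg (Ltilde :: ('v, 'v ltilde_gen, 'k::field_char_0) dg_lie) (w ! a)))
     (lin_ext (\<lambda>b. vec (w[i := b])) (- ltilde_dif (w ! i))) :: _ \<Rightarrow>\<^sub>0 'k"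
  shows "t \<in> tensors Ltilde I (k - 1)"
    and "lin_ext word_vec t
      = - smul (list_sign idx (word_roots w)) (pair_term (word_arcs w) (w ! i) (w ! i))"
proof -
  define u z where "u = take i w" and "z = drop (Suc i) w"
  have w_eq: "w = u @ w ! i # z" unfolding u_def z_def using i by (rule id_take_nth_drop)
  have upd: "w[i := b] = u @ b # z" for b unfolding u_def z_def using i by (rule upd_conv_take_nth_drop)
  have t: "t = smul ((-1) ^ length (word_roots u)) (lin_ext (\<lambda>b. vec (u @ b # z)) (- ltilde_dif (w ! i)))"
    unfolding t_def upd using sum_sdeg_Ltilde[of i w, where 'k = 'k] i by (simp add: u_def)
  have f: "forest_list w" "word_labels w = I" "int (length (word_roots w)) = k"
    using w by (auto simp: forests_def)
  have "t \<in> tensors Ltilde I (k - 1) \<and> lin_ext word_vec t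
      = - smul (list_sign idx (word_roots w)) (pair_term (word_arcs w) (w ! i) (w ! i))"
  proof (cases "w ! i")
    case (DCyc C)
    then show ?thesis
      by (simp add: t pair_term_def free_vs.subspace_0 subspace_tensors)
  next
    case (Tree T)
    have w_T: "w = u @ Tree T # z" using w_eq Tree by simp
    have m: "mset w = mset (Tree T # u @ z)" by (simp add: w_T)
    have fT: "forest_list (Tree T # u @ z)" using forest_list_mset[OF m f(1)] .
    have new: "u @ close_up T v # z \<in> forests I (k - 1)"
      "word_arcs (u @ close_up T v # z) = insert (root T, v) (word_arcs w)"
      "word_roots (u @ close_up T v # z) = word_roots u @ word_roots z"
      if v: "v \<in> pverts T - {root T}" for v
    proof -
      note c = close_up_forest_list[OF fT v]
      have "close_up T v # u @ z \<in> forests I (k - 1)"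
        using c f word_mset_cong[OF m] by (simp add: forests_def)
      then show "u @ close_up T v # z \<in> forests I (k - 1)" by (rule forests_mset) simp
      show "word_arcs (u @ close_up T v # z) = insert (root T, v) (word_arcs w)"
        by (auto simp: w_T)
      show "word_roots (u @ close_up T v # z) = word_roots u @ word_roots z" by simp
    qed
    have t': "t = - smul ((-1) ^ length (word_roots u))
        (\<Sum>v\<in>pverts T - {root T}. vec (u @ close_up T v # z))"
      unfolding t Tree ltilde_dif_Tree by (simp add: lin_ext_minus lin_ext_sum)
    have "t \<in> tensors Ltilde I (k - 1)"
      unfolding t' using new(1)
      by (intro free_vs.subspace_neg free_vs.subspace_scale free_vs.subspace_sum subspace_tensors)
        (simp add: tensors_Ltilde)
    moreover have "(list_sign idx (word_roots w) * eps idx (root T) (rootset I (word_arcs w)) :: 'k)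
        = (-1) ^ length (word_roots u) * list_sign idx (word_roots u @ word_roots z)"
    proof -
      have wr: "word_roots w = word_roots u @ root T # word_roots z" by (simp add: w_T)
      have "rootset I (word_arcs w) = set (word_roots w)" using set_word_roots[OF f(1)] f(2) by simp
      then show ?thesis
        using list_sign_remove[of "word_roots u" "root T" "word_roots z" idx, where 'k = 'k]
          distinct_word_roots[OF f(1)] inj_idx_word_roots[OF f(1,2)] by (simp only: wr)
    qed
    moreover have "lin_ext word_vec t = - smul ((-1) ^ length (word_roots u))
        (\<Sum>v\<in>pverts T - {root T}. smul (list_sign idx (word_roots u @ word_roots z))
           (vec (insert (root T, v) (word_arcs w))))"
    proof -
      have "word_vec (u @ close_up T v # z) = smul (list_sign idx (word_roots u @ word_roots z))
          (vec (insert (root T, v) (word_arcs w)) :: _ \<Rightarrow>\<^sub>0 'k)" if "v \<in> pverts T - {root T}" for v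
        by (simp only: word_vec_def new[OF that])
      then show ?thesis
        unfolding t' lin_ext_minus lin_ext_smul lin_ext_sum lin_ext_vec
        by (intro arg_cong[where f = uminus] arg_cong[where f = "smul _"] sum.cong refl)
    qed
    ultimately show ?thesis
      by (simp add: Tree pair_term_def arrow_term_def flip: free_vs.scale_sum_right)
  qed
  then show "t \<in> tensors Ltilde I (k - 1)" "lin_ext word_vec t
      = - smul (list_sign idx (word_roots w)) (pair_term (word_arcs w) (w ! i) (w ! i))" by auto
qed

text \<open>With both factors already in front, no Koszul sign arises. By disjointness, removing
  \<open>r\<close> from the labels of \<open>x\<close> changes nothing; it gives the sum the shape
  of \<open>arrow_term\<close>.\<close>

lemma graft_terms_word:
  assumes w: "x # y # w \<in> forests I k"
  defines "p \<equiv> lin_ext (\<lambda>b. vec (b # w)) (graft_terms x y) :: _ \<Rightarrow>\<^sub>0 'k::field_char_0"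
  shows "p \<in> tensors Ltilde I (k - 1)"
    and "lin_ext word_vec p = (\<Sum>r\<in>set (ltilde_roots y). smul (list_sign idx (word_roots (x # w)))
      (\<Sum>v\<in>ltilde_labels x - {r}. vec (insert (r, v) (word_arcs (x # y # w)))))"
proof -
  have "p \<in> tensors Ltilde I (k - 1) \<and> lin_ext word_vec p
    = (\<Sum>r\<in>set (ltilde_roots y). smul (list_sign idx (word_roots (x # w)))
      (\<Sum>v\<in>ltilde_labels x - {r}. vec (insert (r, v) (word_arcs (x # y # w)))))"
  proof (cases y)
    case (DCyc C)
    then show ?thesis
      by (simp add: p_def graft_terms_def free_vs.subspace_0 subspace_tensors)
  next
    case (Tree T)
    have f: "forest_list (x # Tree T # w)" using w Tree by (simp add: forests_def)
    have p: "p = (\<Sum>v\<in>ltilde_labels x. vec (attach x T v # w))"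
      by (simp add: p_def graft_terms_def Tree lin_ext_sum)
    have "attach x T v # w \<in> forests I (k - 1)" if "v \<in> ltilde_labels x" for v
      using attach_forest_list[OF f that] w Tree by (simp add: forests_def)
    then have "p \<in> tensors Ltilde I (k - 1)"
      unfolding p by (intro free_vs.subspace_sum subspace_tensors) (simp add: tensors_Ltilde)
    moreover have "lin_ext word_vec p = (\<Sum>v\<in>ltilde_labels x.
        smul (list_sign idx (word_roots (x # w))) (vec (insert (root T, v) (word_arcs (x # Tree T # w)))))"
      unfolding p lin_ext_sum lin_ext_vec
      by (intro sum.cong refl) (simp only: word_vec_def attach_forest_list[OF f])
    moreover have "root T \<in> pverts T" "ltilde_labels x \<inter> pverts T = {}"
      using f ltilde_gensD(6)[of "Tree T"] by auto
    then have "ltilde_labels x - {root T} = ltilde_labels x" by auto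
    ultimately show ?thesis by (simp add: Tree flip: free_vs.scale_sum_right)
  qed
  then show "p \<in> tensors Ltilde I (k - 1)"
    "lin_ext word_vec p = (\<Sum>r\<in>set (ltilde_roots y). smul (list_sign idx (word_roots (x # w)))
      (\<Sum>v\<in>ltilde_labels x - {r}. vec (insert (r, v) (word_arcs (x # y # w)))))" by auto
qed

text \<open>The bracket splits into attaching \<open>y\<close> to \<open>x\<close> and attaching
  \<open>x\<close> to \<open>y\<close>. Removing the attached root and moving the surviving roots to
  the front gives opposite parities in the two cases, which compensates the minus sign between the
  two halves of the bracket.\<close>

lemma d2_term:
  assumes w: "w \<in> forests I k" and ij: "i < j" "j < length w"
  defines "L \<equiv> Ltilde :: ('v, 'v ltilde_gen, 'k::field_char_0) dg_lie"
  defines "t \<equiv> smul ((-1) powi (deg L (w ! i)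
              + sdeg L (w ! i) * (\<Sum>a<i. sdeg L (w ! a))
              + sdeg L (w ! j) * (\<Sum>a\<in>{..<j} - {i}. sdeg L (w ! a))))
       (lin_ext (\<lambda>b. vec (b # nths w (- {i, j}))) (ltilde_lie (w ! i) (w ! j))) :: _ \<Rightarrow>\<^sub>0 'k"
  shows "t \<in> tensors Ltilde I (k - 1)"
    and "lin_ext word_vec t = - smul (list_sign idx (word_roots w))
      (pair_term (word_arcs w) (w ! i) (w ! j) + pair_term (word_arcs w) (w ! j) (w ! i))"
proof -
  define x y u m z where "x = w ! i" and "y = w ! j" and "u = take i w"
    and "m = take (j - Suc i) (drop (Suc i) w)" and "z = drop (Suc j) w"
  have "drop (Suc i) w = m @ y # z"
    using id_take_nth_drop[of "j - Suc i" "drop (Suc i) w"] ij by (simp add: m_def y_def z_def)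
  then have w_eq: "w = u @ x # m @ y # z"
    using id_take_nth_drop[of i w] ij by (simp add: u_def x_def)
  have len: "length u = i" "Suc (i + length m) = j"
    using ij by (auto simp: u_def m_def)
  have nths: "nths w (- {i, j}) = u @ m @ z"
    using nths_remove_two[of u x m y z] by (simp only: w_eq[symmetric] len)
  let ?X = "ltilde_roots x" and ?Y = "ltilde_roots y"
  let ?U = "word_roots u" and ?M = "word_roots m" and ?Z = "word_roots z"
  let ?s = "list_sign idx (word_roots w) :: 'k" and ?A = "word_arcs w"
  \<comment> \<open>The exponent in \<open>d2_CE\<close> is \<open>N - 1\<close>, because
    \<open>deg\<close> of a generator is one less than the length of its root list; this -1 supplies
    the overall minus sign.\<close>
  define N where "N = length ?X + length ?X * length ?U + length ?Y * (length ?U + length ?M)"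
  have f: "forest_list w" "word_labels w = I" "int (length (word_roots w)) = k"
    using w by (auto simp: forests_def)
  have wr: "word_roots w = ?U @ ?X @ ?M @ ?Y @ ?Z" by (simp add: w_eq)
  have R: "rootset I ?A = set (word_roots w)" using set_word_roots[OF f(1)] f(2) by simp
  note dist = distinct_word_roots[OF f(1)] and inj = inj_idx_word_roots[OF f(1,2)]

  have "(\<Sum>a\<in>{..<j} - {i}. sdeg L (w ! a)) = (\<Sum>a<j. sdeg L (w ! a)) - sdeg L x"
    using ij by (simp add: sum_diff1 x_def)
  also have "(\<Sum>a<j. sdeg L (w ! a)) = int (length (word_roots (take j w)))"
    using sum_sdeg_Ltilde[of j w, where 'k = 'k] ij by (simp add: L_def)
  also have "take j w = u @ x # m" by (simp add: w_eq flip: len)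
  finally have sj: "(\<Sum>a\<in>{..<j} - {i}. sdeg L (w ! a)) = int (length ?U + length ?M)"
    by (simp add: L_def sdeg_Ltilde)
  have si: "(\<Sum>a<i. sdeg L (w ! a)) = int (length ?U)"
    using sum_sdeg_Ltilde[of i w, where 'k = 'k] ij by (simp add: L_def u_def)
  have dx: "deg L x = int (length ?X) - 1"
    using sdeg_Ltilde[of x, where 'k = 'k] by (simp add: sdeg_def L_def)
  have "deg L x + sdeg L x * (\<Sum>a<i. sdeg L (w ! a))
      + sdeg L y * (\<Sum>a\<in>{..<j} - {i}. sdeg L (w ! a)) = int N - 1"
    unfolding si sj dx by (simp add: N_def L_def sdeg_Ltilde)
  moreover have "(-1 :: 'k) powi (int N - 1) = - ((-1) ^ N)"
    by (simp add: power_int_diff)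
  ultimately have "t = smul (- ((-1) ^ N)) (lin_ext (\<lambda>b. vec (b # u @ m @ z)) (graft_terms x y - graft_terms y x))"
    unfolding t_def nths ltilde_lie_eq x_def[symmetric] y_def[symmetric] by simp
  then have t: "t = smul (- ((-1) ^ N)) (lin_ext (\<lambda>b. vec (b # u @ m @ z)) (graft_terms x y))
      + smul ((-1) ^ N) (lin_ext (\<lambda>b. vec (b # u @ m @ z)) (graft_terms y x))"
    by (simp add: lin_ext_diff free_vs.scale_right_diff_distrib)

  have mxy: "mset w = mset (x # y # u @ m @ z)" and myx: "mset w = mset (y # x # u @ m @ z)"
    by (simp_all add: w_eq)
  note gxy = graft_terms_word[OF forests_mset[OF w mxy], where 'k = 'k]
    and gyx = graft_terms_word[OF forests_mset[OF w myx], where 'k = 'k]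
  show "t \<in> tensors Ltilde I (k - 1)"
    unfolding t by (intro free_vs.subspace_add free_vs.subspace_scale subspace_tensors gxy(1) gyx(1))

  have 1: "smul (- ((-1) ^ N)) (lin_ext word_vec (lin_ext (\<lambda>b. vec (b # u @ m @ z)) (graft_terms x y)))
      = - smul ?s (pair_term ?A y x)"
  proof (cases y)
    case (Tree T)
    have "(?s * eps idx (root T) (rootset I ?A) :: 'k)
        = (-1) ^ N * list_sign idx (word_roots (x # u @ m @ z))"
      using list_sign_remove_second[of ?U ?X ?M "root T" ?Z idx, where 'k = 'k]
        dist inj length_ltilde_roots[of x]
      unfolding R wr by (simp add: Tree N_def add.assoc)
    then show ?thesis
      unfolding gxy(2) word_mset_cong(2)[OF mxy, symmetric]
      by (simp add: Tree pair_term_def arrow_term_def)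
  next
    case (DCyc C)
    then show ?thesis unfolding gxy(2) by (simp add: pair_term_def)
  qed
  \<comment> \<open>Here the root of \<open>x\<close> disappears. With \<open>length ?X = 1\<close>,
    the exponent \<open>N\<close> exceeds that of \<open>list_sign_remove_first\<close> by one,
    whence the extra minus sign.\<close>
  have 2: "smul ((-1) ^ N) (lin_ext word_vec (lin_ext (\<lambda>b. vec (b # u @ m @ z)) (graft_terms y x)))
      = - smul ?s (pair_term ?A x y)"
  proof (cases x)
    case (Tree T)
    have "(?s * eps idx (root T) (rootset I ?A) :: 'k)
        = - ((-1) ^ N * list_sign idx (word_roots (y # u @ m @ z)))"
      using list_sign_remove_first[of ?U "root T" ?M ?Y ?Z idx, where 'k = 'k]
        dist inj length_ltilde_roots[of y]
      unfolding R wr by (simp add: Tree N_def add.assoc)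
    then show ?thesis
      unfolding gyx(2) word_mset_cong(2)[OF myx, symmetric]
      by (simp add: Tree pair_term_def arrow_term_def)
  next
    case (DCyc C)
    then show ?thesis unfolding gyx(2) by (simp add: pair_term_def)
  qed
  show "lin_ext word_vec t = - smul ?s (pair_term ?A (w ! i) (w ! j) + pair_term ?A (w ! j) (w ! i))"
    unfolding t lin_ext_add lin_ext_smul 1 2
    by (simp add: free_vs.scale_right_distrib x_def y_def)
qed

lemma d_CE_word:
  assumes w: "w \<in> forests I k"
  defines "t \<equiv> d1_CE Ltilde w + d2_CE Ltilde w :: _ \<Rightarrow>\<^sub>0 'k::field_char_0"
  shows "t \<in> tensors Ltilde I (k - 1)"
    and "lin_ext word_vec t = - lin_ext bd (word_vec w)"
proof -
  have dif: "dif (Ltilde :: ('v, 'v ltilde_gen, 'k) dg_lie) = ltilde_dif"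
    and lie: "lie (Ltilde :: ('v, 'v ltilde_gen, 'k) dg_lie) = ltilde_lie"
    by (simp_all add: Ltilde_def)
  show "t \<in> tensors Ltilde I (k - 1)"
    unfolding t_def d1_CE_def d2_CE_def dif lie
    by (intro free_vs.subspace_add free_vs.subspace_sum subspace_tensors d1_term[OF w] d2_term[OF w]) auto
  let ?s = "list_sign idx (word_roots w) :: 'k" and ?A = "word_arcs w" and ?n = "length w"
  let ?p = "\<lambda>i j. pair_term ?A (w ! i) (w ! j) :: _ \<Rightarrow>\<^sub>0 'k"
  have "lin_ext word_vec (d1_CE Ltilde w) = (\<Sum>i<?n. - smul ?s (?p i i))"
    unfolding d1_CE_def dif lin_ext_sum by (intro sum.cong refl d1_term(2)[OF w]) simp
  moreover have "lin_ext word_vec (d2_CE Ltilde w) = (\<Sum>j<?n. \<Sum>i<j. - smul ?s (?p i j + ?p j i))"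
    unfolding d2_CE_def lie lin_ext_sum by (intro sum.cong refl d2_term(2)[OF w]) auto
  ultimately have "lin_ext word_vec t
      = - smul ?s ((\<Sum>i<?n. ?p i i) + (\<Sum>j<?n. \<Sum>i<j. ?p i j + ?p j i))"
    by (simp only: t_def lin_ext_add sum_negf free_vs.scale_right_distrib free_vs.scale_sum_right) simp
  also have "\<dots> = - smul ?s (bd ?A)"
    using w bd_word_arcs[of w, where 'k = 'k] sum_square_split[of ?p ?n] by (simp add: forests_def)
  finally show "lin_ext word_vec t = - lin_ext bd (word_vec w)"
    by (simp add: word_vec_def lin_ext_smul)
qed

section \<open>The comparison map on coinvariants\<close>

lemma word_arcs_arrow_basis: "w \<in> forests I k \<Longrightarrow> word_arcs w \<in> arrow_basis k"
  using forest_list_loopfree[of w] set_word_roots[of w] distinct_card[OF distinct_word_roots[of w]]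
  by (auto simp: forests_def arrow_basis_def)

lemma word_vec_arrow_chains: "w \<in> forests I k \<Longrightarrow> word_vec w \<in> arrow_chains k"
  unfolding word_vec_def
  by (rule free_vs.subspace_scale[OF subspace_arrow_chains])
    (simp add: arrow_chains_def word_arcs_arrow_basis)

text \<open>The arcs do not depend on the order of the factors. The root list changes only if both
  factors are trees, and then by an adjacent transposition.\<close>

lemma word_vec_swap:
  assumes "u @ [x, y] @ v \<in> forests I k"
  shows "word_vec (u @ [x, y] @ v)
    = (smul ((-1) ^ (length (ltilde_roots x) * length (ltilde_roots y))) (word_vec (u @ [y, x] @ v)) :: _ \<Rightarrow>\<^sub>0 'k::field_char_0)"
proof -
  have f: "forest_list (u @ [x, y] @ v)" "word_labels (u @ [x, y] @ v) = I"
    using assms by (auto simp: forests_def)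
  note d = distinct_word_roots[OF f(1)] inj_idx_word_roots[OF f]
  have arcs: "word_arcs (u @ [x, y] @ v) = word_arcs (u @ [y, x] @ v)" by auto
  have "(list_sign idx (word_roots (u @ [x, y] @ v)) :: 'k)
      = (-1) ^ (length (ltilde_roots x) * length (ltilde_roots y)) * list_sign idx (word_roots (u @ [y, x] @ v))"
  proof (cases "\<exists>S T. x = Tree S \<and> y = Tree T")
    case True
    then obtain S T where xy: "x = Tree S" "y = Tree T" by blast
    show ?thesis
      using list_sign_swap[of "word_roots u" "root S" "root T" "word_roots v" idx, where 'k = 'k] d
      by (simp add: xy)
  next
    case False
    then show ?thesis by (cases x; cases y) auto
  qed
  then show ?thesis unfolding word_vec_def arcs by simp
qed

lemma sym_relations_subset_kernel:
  assumes "x \<in> sym_relations Ltilde I k"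
  shows "x \<in> tensors Ltilde I k" and "lin_ext word_vec x = (0 :: _ \<Rightarrow>\<^sub>0 'k::field_char_0)"
proof -
  have vec_tensors: "(vec w :: _ \<Rightarrow>\<^sub>0 'k) \<in> tensors Ltilde I k" if "w \<in> forests I k" for w
    using that by (simp add: tensors_Ltilde)
  have "sym_relations Ltilde I k
      \<subseteq> tensors Ltilde I k \<inter> {x. lin_ext word_vec x = (0 :: _ \<Rightarrow>\<^sub>0 'k)}"
    unfolding sym_relations_Ltilde
  proof (rule free_vs.span_minimal, safe)
    fix u x y v assume uv: "u @ [x, y] @ v \<in> forests I k"
    let ?c = "(-1 :: 'k) ^ (length (ltilde_roots x) * length (ltilde_roots y))"
    have "u @ [y, x] @ v \<in> forests I k" using uv by (rule forests_mset) simp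
    then show "vec (u @ [x, y] @ v) - smul ?c (vec (u @ [y, x] @ v)) \<in> tensors Ltilde I k"
      using uv by (intro free_vs.subspace_diff free_vs.subspace_scale subspace_tensors vec_tensors)
    show "lin_ext word_vec (vec (u @ [x, y] @ v) - smul ?c (vec (u @ [y, x] @ v))) = (0 :: _ \<Rightarrow>\<^sub>0 'k)"
      unfolding lin_ext_diff lin_ext_smul lin_ext_vec word_vec_swap[OF uv] by simp
  next
    show "free_vs.subspace (tensors Ltilde I k \<inter> {x. lin_ext word_vec x = (0 :: _ \<Rightarrow>\<^sub>0 'k)})"
      by (intro free_vs.subspace_inter subspace_tensors)
        (auto simp: free_vs.subspace_def lin_ext_add lin_ext_smul)
  qed
  then show "x \<in> tensors Ltilde I k" and "lin_ext word_vec x = (0 :: _ \<Rightarrow>\<^sub>0 'k)" using assms by auto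
qed

text \<open>The scalar is left unspecified: \<open>word_vec\<close> determines it afterwards, so no
  sign is tracked through a permutation. The \<open>itself\<close> argument fixes the field, which
  does not occur in the words.\<close>

definition word_rel :: "int \<Rightarrow> 'k::field_char_0 itself \<Rightarrow> 'v ltilde_gen list \<Rightarrow> 'v ltilde_gen list \<Rightarrow> bool" where
  "word_rel k _ w w' \<longleftrightarrow> (\<exists>c :: 'k. vec w - smul c (vec w') \<in> sym_relations Ltilde I k)"

lemma word_rel_refl: "word_rel k TYPE('k::field_char_0) w w"
  unfolding word_rel_def
  by (rule exI[of _ 1]) (simp add: free_vs.subspace_0 subspace_sym_relations)

lemma word_rel_trans:
  assumes "word_rel k TYPE('k::field_char_0) w1 w2" "word_rel k TYPE('k) w2 w3"
  shows "word_rel k TYPE('k) w1 w3"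
proof -
  obtain c d :: 'k where c: "vec w1 - smul c (vec w2) \<in> sym_relations Ltilde I k"
    and d: "vec w2 - smul d (vec w3) \<in> sym_relations Ltilde I k"
    using assms by (auto simp: word_rel_def)
  have "(vec w1 - smul c (vec w2)) + smul c (vec w2 - smul d (vec w3)) \<in> sym_relations Ltilde I k"
    by (intro free_vs.subspace_add free_vs.subspace_scale subspace_sym_relations c d)
  then have "vec w1 - smul (c * d) (vec w3) \<in> sym_relations Ltilde I k"
    by (simp add: free_vs.scale_right_diff_distrib)
  then show ?thesis by (auto simp: word_rel_def)
qed

lemma word_rel_swap:
  assumes "u @ [x, y] @ v \<in> forests I k"
  shows "word_rel k TYPE('k::field_char_0) (u @ [x, y] @ v) (u @ [y, x] @ v)"
  unfolding word_rel_def sym_relations_Ltilde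
  by (rule exI, rule free_vs.span_base) (use assms in blast)

lemma word_rel_move:
  assumes "u @ x # a @ b \<in> forests I k"
  shows "word_rel k TYPE('k::field_char_0) (u @ x # a @ b) (u @ a @ x # b)"
  using assms
proof (induction a arbitrary: u)
  case (Cons y a)
  have "word_rel k TYPE('k) (u @ x # y # a @ b) (u @ y # x # a @ b)"
    using word_rel_swap[of u x y "a @ b" k] Cons.prems by simp
  moreover have "(u @ [y]) @ x # a @ b \<in> forests I k"
    using Cons.prems by (rule forests_mset) simp
  then have "word_rel k TYPE('k) (u @ y # x # a @ b) (u @ y # a @ x # b)"
    using Cons.IH[of "u @ [y]"] by simp
  ultimately show ?case by (auto intro: word_rel_trans)
qed (simp add: word_rel_refl)

lemma word_rel_mset:
  assumes "u @ w \<in> forests I k" "mset w = mset w'"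
  shows "word_rel k TYPE('k::field_char_0) (u @ w) (u @ w')"
  using assms
proof (induction w arbitrary: u w')
  case (Cons x w)
  then have "x \<in> set w'" by (metis list.set_intros(1) mset_eq_setD)
  then obtain a b where w': "w' = a @ x # b" by (meson split_list)
  then have "mset w = mset (a @ b)" using Cons.prems by simp
  then have "word_rel k TYPE('k) (u @ x # w) (u @ x # a @ b)"
    using Cons.IH[of "u @ [x]" "a @ b"] Cons.prems by simp
  moreover have "u @ x # a @ b \<in> forests I k"
    using Cons.prems(1) by (rule forests_mset) (use Cons.prems w' in simp)
  ultimately show ?case unfolding w' by (blast intro: word_rel_trans word_rel_move)
qed (simp add: word_rel_refl)

definition choose_word :: "('v \<times> 'v) set \<Rightarrow> 'v ltilde_gen list" where
  "choose_word A = (SOME w. forest_list w \<and> word_labels w = I \<and> word_arcs w = A)"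

lemma choose_word:
  assumes "A \<in> arrow_basis k" "I \<noteq> {}"
  shows "choose_word A \<in> forests I k" and "word_arcs (choose_word A) = A"
proof -
  let ?w = "choose_word A"
  have "\<exists>w. forest_list w \<and> word_labels w = I \<and> word_arcs w = A"
    using assms(1) by (intro forest_list_exists finite_I) (simp add: arrow_basis_def)
  from someI_ex[OF this] have w: "forest_list ?w" "word_labels ?w = I" "word_arcs ?w = A"
    unfolding choose_word_def by auto
  then show "word_arcs ?w = A" by simp
  have "?w \<noteq> []" using w(2) assms(2) by auto
  then show "?w \<in> forests I k"
    using w assms(1) distinct_card[OF distinct_word_roots[OF w(1)]]
    by (simp add: forests_def set_word_roots arrow_basis_def)
qed

text \<open>On functions admitting a word this is a section of \<open>word_vec\<close>: the sign of
  the chosen word is its own inverse and cancels the one in \<open>word_vec\<close>.\<close>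

definition arrow_lift :: "('v \<times> 'v) set \<Rightarrow> ('v ltilde_gen list \<Rightarrow>\<^sub>0 'k::field_char_0)" where
  "arrow_lift A = smul (list_sign idx (word_roots (choose_word A))) (vec (choose_word A))"

lemma word_vec_surj:
  assumes p: "p \<in> arrow_chains k" and "I \<noteq> {}"
  shows "\<exists>x\<in>tensors Ltilde I k. lin_ext word_vec x = (p :: _ \<Rightarrow>\<^sub>0 'k::field_char_0)"
proof (intro bexI[of _ "lin_ext arrow_lift p"])
  have keys: "A \<in> arrow_basis k" if "A \<in> Poly_Mapping.keys p" for A
    using p that by (auto simp: arrow_chains_def)
  have "lin_ext word_vec (arrow_lift A) = (vec A :: _ \<Rightarrow>\<^sub>0 'k)" if "A \<in> Poly_Mapping.keys p" for A
    using choose_word(2)[OF keys[OF that] assms(2)]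
    by (simp add: arrow_lift_def lin_ext_smul word_vec_def)
  then have "lin_ext word_vec (lin_ext arrow_lift p) = lin_ext vec p"
    unfolding lin_ext_lin_ext by (rule lin_ext_cong)
  then show "lin_ext word_vec (lin_ext arrow_lift p) = p" by (simp add: lin_ext_vec_id)
  show "lin_ext arrow_lift p \<in> tensors Ltilde I k"
    using choose_word(1)[OF keys assms(2)] unfolding arrow_lift_def
    by (intro lin_ext_in_subspace subspace_tensors free_vs.subspace_scale) (auto simp: tensors_Ltilde)
qed

text \<open>Words with the same function have the same factors, hence agree up to a scalar modulo
  the relations. So every word differs from the lift of its image by a relation, and the combination
  of these differences is \<open>x\<close> itself when its image vanishes.\<close>

lemma word_vec_kernel:
  assumes x: "x \<in> tensors Ltilde I k" and "I \<noteq> {}"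
    and ker: "lin_ext word_vec x = (0 :: _ \<Rightarrow>\<^sub>0 'k::field_char_0)"
  shows "x \<in> sym_relations Ltilde I k"
proof -
  have "vec w - lin_ext arrow_lift (word_vec w :: _ \<Rightarrow>\<^sub>0 'k) \<in> sym_relations Ltilde I k"
    if "w \<in> Poly_Mapping.keys x" for w
  proof -
    have w: "w \<in> forests I k" using x that by (auto simp: tensors_Ltilde)
    have f: "forest_list w" "word_labels w = I" using w by (auto simp: forests_def)
    have A: "word_arcs w \<in> arrow_basis k" using w by (rule word_arcs_arrow_basis)
    let ?w = "choose_word (word_arcs w)"
    have cw: "?w \<in> forests I k" "word_arcs ?w = word_arcs w" using choose_word[OF A assms(2)] by auto
    then have "mset w = mset ?w" using f by (intro forest_list_unique) (auto simp: forests_def)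
    then have "word_rel k TYPE('k) w ?w" using word_rel_mset[of "[]" w k ?w] w by simp
    then obtain c :: 'k where c: "vec w - smul c (vec ?w) \<in> sym_relations Ltilde I k"
      by (auto simp: word_rel_def)
    let ?s = "list_sign idx (word_roots w) :: 'k" and ?t = "list_sign idx (word_roots ?w) :: 'k"
    \<comment> \<open>Relations lie in the kernel of \<open>word_vec\<close>, which forces the
      unknown scalar \<open>c\<close> to be the product of the two signs.\<close>
    have "word_vec w = smul c (word_vec ?w)"
      using sym_relations_subset_kernel(2)[OF c] by (simp add: lin_ext_diff lin_ext_smul)
    then have "Poly_Mapping.lookup (word_vec w) (word_arcs w)
        = Poly_Mapping.lookup (smul c (word_vec ?w)) (word_arcs w)" by simp
    then have "?s = c * ?t" by (simp add: word_vec_def cw(2) lookup_smul)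
    then have "?s * ?t = c" by (simp add: mult.assoc)
    then show ?thesis using c by (simp add: word_vec_def lin_ext_smul arrow_lift_def)
  qed
  then have "lin_ext (\<lambda>w. vec w - lin_ext arrow_lift (word_vec w :: _ \<Rightarrow>\<^sub>0 'k)) x \<in> sym_relations Ltilde I k"
    by (rule lin_ext_in_subspace[OF subspace_sym_relations])
  moreover have "lin_ext (\<lambda>w. vec w - lin_ext arrow_lift (word_vec w :: _ \<Rightarrow>\<^sub>0 'k)) x
      = x - lin_ext arrow_lift (lin_ext word_vec x)"
    by (simp only: lin_ext_diff_fun lin_ext_vec_id lin_ext_lin_ext)
  ultimately show ?thesis by (simp add: ker)
qed

lemma d_CE_tensors:
  assumes "x \<in> tensors Ltilde I k"
  shows "d_CE Ltilde x \<in> tensors Ltilde I (k - 1)"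
    and "lin_ext word_vec (d_CE Ltilde x) = - lin_ext bd (lin_ext word_vec x :: _ \<Rightarrow>\<^sub>0 'k::field_char_0)"
proof -
  have keys: "w \<in> forests I k" if "w \<in> Poly_Mapping.keys x" for w
    using assms that by (auto simp: tensors_Ltilde)
  show "d_CE Ltilde x \<in> tensors Ltilde I (k - 1)"
    unfolding d_CE_def by (intro lin_ext_in_subspace subspace_tensors d_CE_word(1) keys)
  have "lin_ext word_vec (d_CE Ltilde x) = lin_ext (\<lambda>w. - lin_ext bd (word_vec w :: _ \<Rightarrow>\<^sub>0 'k)) x"
    unfolding d_CE_def lin_ext_lin_ext by (intro lin_ext_cong d_CE_word(2)[OF keys])
  then show "lin_ext word_vec (d_CE Ltilde x) = - lin_ext bd (lin_ext word_vec x :: _ \<Rightarrow>\<^sub>0 'k)"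
    by (simp only: lin_ext_uminus_fun lin_ext_lin_ext)
qed

section \<open>Transfer of the homology to words\<close>

lemma lin_ext_word_vec_arrow_chains:
  "x \<in> tensors Ltilde I k \<Longrightarrow> lin_ext word_vec x \<in> (arrow_chains k :: (_ \<Rightarrow>\<^sub>0 'k::field_char_0) set)"
  by (rule lin_ext_in_subspace[OF subspace_arrow_chains])
    (auto simp: tensors_Ltilde intro: word_vec_arrow_chains)

text \<open>Among tensors, \<open>word_vec\<close> kills exactly the relations, so
  \<open>d_CE\<close> lands in the relations precisely when its image under \<open>word_vec\<close>
  is zero; by anticommutation this means that the image of \<open>x\<close> is a cycle.\<close>

lemma CE_cycles_Ltilde:
  assumes "I \<noteq> {}"
  shows "CE_cycles Ltilde I k
    = {x \<in> tensors Ltilde I k. lin_ext word_vec x \<in> (arrow_cycles k :: (_ \<Rightarrow>\<^sub>0 'k::field_char_0) set)}"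
proof -
  have "d_CE Ltilde x \<in> sym_relations Ltilde I (k - 1) \<longleftrightarrow> lin_ext word_vec x \<in> (arrow_cycles k :: (_ \<Rightarrow>\<^sub>0 'k) set)"
    if x: "x \<in> tensors Ltilde I k" for x
  proof -
    have "d_CE Ltilde x \<in> sym_relations Ltilde I (k - 1)
        \<longleftrightarrow> lin_ext word_vec (d_CE Ltilde x) = (0 :: _ \<Rightarrow>\<^sub>0 'k)"
      using word_vec_kernel[OF d_CE_tensors(1)[OF x] assms] sym_relations_subset_kernel(2) by blast
    then show ?thesis
      using lin_ext_word_vec_arrow_chains[OF x] by (simp add: d_CE_tensors(2)[OF x] arrow_cycles_def)
  qed
  then show ?thesis by (auto simp: CE_cycles_def)
qed

lemma CE_boundaries_Ltilde:
  assumes "I \<noteq> {}"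
  shows "CE_boundaries Ltilde I k
    = {x \<in> tensors Ltilde I k. lin_ext word_vec x \<in> (arrow_boundaries k :: (_ \<Rightarrow>\<^sub>0 'k::field_char_0) set)}"
proof (intro equalityI subsetI)
  fix x :: "_ \<Rightarrow>\<^sub>0 'k" assume "x \<in> CE_boundaries Ltilde I k"
  then obtain c r where x: "x = d_CE Ltilde c + r" and c: "c \<in> tensors Ltilde I (k + 1)"
    and r: "r \<in> sym_relations Ltilde I k"
    by (auto simp: CE_boundaries_def)
  have "x \<in> tensors Ltilde I k"
    using d_CE_tensors(1)[OF c] sym_relations_subset_kernel(1)[OF r]
    by (simp add: x free_vs.subspace_add subspace_tensors)
  \<comment> \<open>The sign of \<open>c\<close> is reversed because the comparison map anticommutes
    with the differentials.\<close>
  moreover have "lin_ext word_vec x = lin_ext bd (lin_ext word_vec (- c))"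
    by (simp add: x lin_ext_add lin_ext_minus d_CE_tensors(2)[OF c] sym_relations_subset_kernel(2)[OF r])
  moreover have "- c \<in> tensors Ltilde I (k + 1)" by (rule free_vs.subspace_neg[OF subspace_tensors c])
  ultimately show "x \<in> {x \<in> tensors Ltilde I k. lin_ext word_vec x \<in> (arrow_boundaries k :: (_ \<Rightarrow>\<^sub>0 'k) set)}"
    using lin_ext_word_vec_arrow_chains by (auto simp: arrow_boundaries_def)
next
  fix x :: "_ \<Rightarrow>\<^sub>0 'k"
  assume "x \<in> {x \<in> tensors Ltilde I k. lin_ext word_vec x \<in> (arrow_boundaries k :: (_ \<Rightarrow>\<^sub>0 'k) set)}"
  then obtain y :: "_ \<Rightarrow>\<^sub>0 'k" where x: "x \<in> tensors Ltilde I k" and y: "y \<in> arrow_chains (k + 1)"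
    "lin_ext word_vec x = lin_ext bd y" by (auto simp: arrow_boundaries_def)
  obtain c where c: "c \<in> tensors Ltilde I (k + 1)" "lin_ext word_vec c = y"
    using word_vec_surj[OF y(1) assms] by blast
  have c': "- c \<in> tensors Ltilde I (k + 1)" by (rule free_vs.subspace_neg[OF subspace_tensors c(1)])
  have d: "d_CE Ltilde (- c) \<in> tensors Ltilde I k" using d_CE_tensors(1)[OF c'] by simp
  have "lin_ext word_vec (x - d_CE Ltilde (- c)) = (0 :: _ \<Rightarrow>\<^sub>0 'k)"
    by (simp add: lin_ext_diff d_CE_tensors(2)[OF c'] lin_ext_minus c(2) y(2))
  then have "x - d_CE Ltilde (- c) \<in> sym_relations Ltilde I k"
    by (rule word_vec_kernel[OF free_vs.subspace_diff[OF subspace_tensors x d] assms])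
  then show "x \<in> CE_boundaries Ltilde I k"
    unfolding CE_boundaries_def using c' by force
qed

lemma CE_homology_Ltilde:
  assumes "I \<noteq> {}"
    and "quotient_has_dim (arrow_cycles k :: (_ \<Rightarrow>\<^sub>0 'k::field_char_0) set) (arrow_boundaries k) m"
  shows "CE_homology_has_dim (Ltilde :: ('v, 'v ltilde_gen, 'k) dg_lie) I k m"
  unfolding CE_homology_has_dim_def
proof (rule quotient_has_dim_lift[OF subspace_tensors _ CE_cycles_Ltilde[OF assms(1)]
      CE_boundaries_Ltilde[OF assms(1)] assms(2)])
  fix y :: "_ \<Rightarrow>\<^sub>0 'k" assume "y \<in> arrow_cycles k"
  then show "\<exists>x\<in>tensors Ltilde I k. lin_ext word_vec x = y"
    using word_vec_surj[OF _ assms(1)] by (auto simp: arrow_cycles_def)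
qed

end

text \<open>The empty set stands apart: the complex of functions would contribute the empty function
  in degree 0, but symmetric powers start at \<open>n = 1\<close> and label sets are nonempty, so
  there are no words.\<close>

lemma CE_homology_Ltilde_empty:
  "CE_homology_has_dim (Ltilde :: ('v, 'v ltilde_gen, 'k::field_char_0) dg_lie) {} k 0"
proof -
  have "forests ({} :: 'v set) k = {}" for k
  proof (rule equals0I)
    fix w assume "w \<in> forests ({} :: 'v set) k"
    then show False using ltilde_gensD(2) by (cases w) (auto simp: forests_def)
  qed
  then have t: "tensors (Ltilde :: ('v, 'v ltilde_gen, 'k) dg_lie) {} k = {0}"
    and s: "sym_relations (Ltilde :: ('v, 'v ltilde_gen, 'k) dg_lie) {} k = {0}" for k
    by (auto simp: tensors_Ltilde sym_relations_Ltilde)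
  have "CE_cycles (Ltilde :: ('v, 'v ltilde_gen, 'k) dg_lie) {} k = {0}"
    "CE_boundaries (Ltilde :: ('v, 'v ltilde_gen, 'k) dg_lie) {} k = {0}"
    by (auto simp: CE_cycles_def CE_boundaries_def t s d_CE_def)
  then show ?thesis
    unfolding CE_homology_has_dim_def
    by (simp add: quotient_has_dim_self free_vs.subspace_single_0)
qed

text \<open>Two labels fall under the general count, which gives \<open>(2 - 2) ^ 2 = 0\<close>;
  hence the threshold 3 in degree 0.\<close>

lemma CE_homology_Ltilde_finite:
  fixes I :: "'v set"
  assumes "finite I"
  shows "CE_homology_has_dim (Ltilde :: ('v, 'v ltilde_gen, 'k::field_char_0) dg_lie) I k
    (if k = 0 \<and> card I \<ge> 3 then (card I - 2) ^ card I else if k = 1 \<and> card I = 1 then 1 else 0)"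
proof (cases "I = {}")
  case True
  then show ?thesis using CE_homology_Ltilde_empty by simp
next
  case False
  obtain idx :: "'v \<Rightarrow> nat" where "inj_on idx I"
    using finite_imp_inj_to_nat_seg[OF assms] by blast
  then interpret enumerated_labels I idx using assms by unfold_locales
  have "card I \<noteq> 0" using False assms by simp
  then consider "card I = 1" | "card I = 2" | "card I \<ge> 3" by linarith
  then show ?thesis
  proof cases
    case 1
    then show ?thesis
      using CE_homology_Ltilde[OF False quotient_has_dim_arrow_singleton[OF 1, of k, where 'k = 'k]] by simp
  next
    case 2
    then show ?thesis
      using CE_homology_Ltilde[OF False quotient_has_dim_arrow[of k, where 'k = 'k]]
      by (cases "k = 0") simp_all
  next
    case 3
    then show ?thesis
      using CE_homology_Ltilde[OF False quotient_has_dim_arrow[of k, where 'k = 'k]]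
      by (cases "k = 0") simp_all
  qed
qed

theorem theorem6p2:
  shows "(\<forall>(I :: 'v set) k. finite I \<longrightarrow> k \<notin> {0, 1} \<longrightarrow>
            CE_homology_has_dim (Ltilde :: ('v, 'v ltilde_gen, 'k::field_char_0) dg_lie) I k 0) \<and>
         (\<forall>(n :: nat) k.
            CE_homology_has_dim (Ltilde :: (nat, nat ltilde_gen, 'k) dg_lie) {1..n} k
              (if k = 0 \<and> n \<ge> 3 then (n - 2) ^ n
               else if k = 1 \<and> n = 1 then 1
               else 0))"
proof (intro conjI allI impI)
  fix I :: "'v set" and k :: int
  assume "finite I" "k \<notin> {0, 1}"
  then show "CE_homology_has_dim (Ltilde :: ('v, 'v ltilde_gen, 'k) dg_lie) I k 0"
    using CE_homology_Ltilde_finite[of I k, where 'k = 'k] by simp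
next
  fix n :: nat and k :: int
  have card_n: "card {1..n} = n" by simp
  show "CE_homology_has_dim (Ltilde :: (nat, nat ltilde_gen, 'k) dg_lie) {1..n} k
      (if k = 0 \<and> n \<ge> 3 then (n - 2) ^ n else if k = 1 \<and> n = 1 then 1 else 0)"
    using CE_homology_Ltilde_finite[of "{1..n}" k, where 'k = 'k]
    by (simp only: finite_atLeastAtMost card_n simp_thms)
qed

end
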